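(* Let $m\ge1$ be an integer and let $q_0,q_1,\dots,q_m$ and $c_1,\dots,c_m,c_{\overline1},\dots,c_{\overline m}$ be commuting indeterminates. Then \begin{align*} \sum_{\lambda\in \overline{\mathcal{P}}} \left(\prod_{j=1}^m c_j^{\rho_j(\lambda)}c_{\overline{j}}^{\rho_{\overline{j}}(\lambda)} \right)q_0^{|\lambda|}\prod_{i=1}^m q_i^{\sum_{j\geq 0}\lambda_{i+jm}} &= \prod_{i=1}^m\frac{(-c_{\overline{i}}q_0^i q_1\cdots q_i;q_0^m q_1\cdots q_m)_\infty}{(c_{i}q_0^i q_1\cdots q_i;q_0^m q_1\cdots q_m)_\infty},\\ \sum_{\lambda\in \mathcal{P}} \left(\prod_{j=1}^m c_j^{\rho_j(\lambda)}\right) q_0^{|\lambda|}\prod_{i=1}^m q_i^{\sum_{j\geq 0}\lambda_{i+jm}} &= \prod_{i=1}^m\frac{1}{(c_{i}q_0^i q_1\cdots q_i;q_0^m q_1\cdots q_m)_\infty},\\ \sum_{\lambda\in \overline{\mathcal{F}}} \left(\prod_{j=1}^m c_{\overline{j}}^{\rho_{\overline{j}}(\lambda)} \right)q_0^{|\lambda|}\prod_{i=1}^m q_i^{\sum_{j\geq 0}\lambda_{i+jm}} &= \prod_{i=1}^m(-c_{\overline{i}}q_0^i q_1\cdots q_i;q_0^m q_1\cdots q_m)_\infty,\\ \sum_{\lambda\in \overline{\mathcal{D}}} \left(\prod_{j=1}^m c_j^{\rho_j(\lambda)}c_{\overline{j}}^{\rho_{\overline{j}}(\lambda)} \right)q_0^{|\lambda|}\prod_{i=1}^m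 q_i^{\sum_{j\geq 0}\lambda_{i+jm}} &=\sum_{n\geq 0} \sum_{\ell=1}^m \prod_{i=1}^{\ell-1}\frac{(c_{\overline{i}}q_0^i q_1\cdots q_i)^{n+1} (q_0^m q_1\cdots q_m)^{\frac{n(n+1)}{2}}}{(c_{i}q_0^i q_1\cdots q_i;q_0^m q_1\cdots q_m)_{n+1}}\\ &\qquad\qquad\cdot \prod_{i=\ell}^{m}\frac{(c_{\overline{i}}q_0^i q_1\cdots q_i)^{n} (q_0^m q_1\cdots q_m)^{\frac{n(n-1)}{2}}}{(c_{i}q_0^i q_1\cdots q_i;q_0^m q_1\cdots q_m)_{n}}. \end{align*}
   Context: Over-lined integers: $\overline{\mathbb{Z}_{\geq 1}}=\{\overline1,\overline2,\ldots\}$ is a disjoint copy of $\mathbb{Z}_{\ge 1}$; both $i$ and $\overline i$ have size $i$; sums and differences use sizes. Order: $0<\overline1<1<\overline2<2<\cdots$. An over-partition is an infinite non-increasing sequence $\lambda=(\lambda_i)_{i\ge1}$ of elements of $\mathbb{Z}_{\geq 0}\sqcup\overline{\mathbb{Z}_{\geq 1}}$ with finitely many nonzero terms, in which each over-lined integer occurs at most once. $\overline{\mathcal P}$: all over-partitions. $\mathcal P$: those without over-lined parts. $\overline{\mathcal D}$: those all of whose positive parts are over-lined. $\overline{\mathcal F}$: those $\lambda$ such that $\overline i$ is a part of $\lambda$ for all $\overline i\le\lambda_1$. $|\lambda|=\sum_i\lambda_i$ is the sum of sizes. For $1\le j\le m$, with $\chi(A)=1$ if $A$ is true and $0$ otherwise,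 $$\rho_j(\lambda)=\sum_{i\ge0}\bigl(\lambda_{j+im}-\lambda_{j+1+im}-\chi(\lambda_{j+im}\text{ is over-lined})\bigr),\qquad \rho_{\overline j}(\lambda)=\#\{i\ge0:\lambda_{j+im}\text{ is over-lined}\}.$$ $(a;x)_n=\prod_{k=0}^{n-1}(1-ax^k)$ for $n\in\mathbb Z_{\ge0}\cup\{\infty\}$. Empty products equal $1$. Identities are between formal power series in the indeterminates. *)

theory Defs
  imports "HOL-Analysis.Analysis" "HOL-Library.Multiset"
begin

section \<open>Formal power series in arbitrarily many commuting indeterminates\<close>

text \<open>
  A monomial in the indeterminates of type \<open>'v\<close> is a finite multiset over \<open>'v\<close>; the product of
  monomials is the sum of multisets. A series is an arbitrary family of coefficients.
\<close>

typedef ('v, 'a) mfps = "UNIV :: ('v multiset \<Rightarrow> 'a) set"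
  morphisms mcoeff Abs_mfps ..

lemma mfps_eqI: "(\<And>M. mcoeff f M = mcoeff g M) \<Longrightarrow> f = g"
  by (metis ext mcoeff_inject)

lemma mcoeff_Abs [simp]: "mcoeff (Abs_mfps f) = f"
  by (simp add: Abs_mfps_inverse)

lemma finite_submultisets: "finite {A. A \<subseteq># M}"
proof (induction M)
  case empty
  then show ?case by simp
next
  case (add x M)
  have "{A. A \<subseteq># add_mset x M} \<subseteq> {A. A \<subseteq># M} \<union> add_mset x ` {A. A \<subseteq># M}"
  proof
    fix A assume "A \<in> {A. A \<subseteq># add_mset x M}"
    then have A: "A \<subseteq># add_mset x M" by simp
    show "A \<in> {A. A \<subseteq># M} \<union> add_mset x ` {A. A \<subseteq># M}"
    proof (cases "x \<in># A")
      case True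
      then obtain B where "A = add_mset x B" by (metis insert_DiffM)
      with A show ?thesis by auto
    next
      case False
      then have "A - {#x#} = A" by (rule diff_single_trivial)
      with A have "A \<subseteq># M" by (metis add_mset_add_single subset_eq_diff_conv)
      then show ?thesis by simp
    qed
  qed
  with add show ?case by (meson finite_UnI finite_imageI finite_subset)
qed

definition msplits :: "'v multiset \<Rightarrow> ('v multiset \<times> 'v multiset) set" where
  "msplits M = {(A, B). A + B = M}"

lemma finite_msplits [simp]: "finite (msplits M)"
proof -
  have "msplits M \<subseteq> {A. A \<subseteq># M} \<times> {A. A \<subseteq># M}"
    by (auto simp: msplits_def)
  then show ?thesis
    by (rule finite_subset) (intro finite_SigmaI finite_submultisets)
qed

lemma msplits_empty [simp]: "msplits {#} = {({#}, {#})}"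
  by (auto simp: msplits_def)

instantiation mfps :: (type, comm_ring_1) comm_ring_1
begin

definition zero_mfps where "0 = Abs_mfps (\<lambda>M. 0)"
definition one_mfps where "1 = Abs_mfps (\<lambda>M. if M = {#} then 1 else 0)"
definition plus_mfps where "f + g = Abs_mfps (\<lambda>M. mcoeff f M + mcoeff g M)"
definition minus_mfps where "f - g = Abs_mfps (\<lambda>M. mcoeff f M - mcoeff g M)"
definition uminus_mfps where "- f = Abs_mfps (\<lambda>M. - mcoeff f M)"
definition times_mfps where
  "f * g = Abs_mfps (\<lambda>M. \<Sum>(A, B)\<in>msplits M. mcoeff f A * mcoeff g B)"

lemma mult_one_mfps: "1 * (f :: ('a, 'b) mfps) = f"
proof (rule mfps_eqI)
  fix M
  have "mcoeff (1 * f) M =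
      (\<Sum>p\<in>msplits M. if p = ({#}, M) then mcoeff f M else 0)"
    unfolding times_mfps_def one_mfps_def
    by (auto simp: msplits_def intro!: sum.cong)
  also have "\<dots> = mcoeff f M"
    by (simp add: sum.delta) (simp add: msplits_def)
  finally show "mcoeff (1 * f) M = mcoeff f M" .
qed

lemma mult_commute_mfps: "f * g = g * (f :: ('a, 'b) mfps)"
proof (rule mfps_eqI)
  fix M
  show "mcoeff (f * g) M = mcoeff (g * f) M"
    unfolding times_mfps_def mcoeff_Abs
    by (rule sum.reindex_bij_witness[where i = prod.swap and j = prod.swap])
       (auto simp: msplits_def ac_simps)
qed

lemma mult_assoc_mfps: "(f * g) * h = f * (g * (h :: ('a, 'b) mfps))"
proof (rule mfps_eqI)
  fix M
  have "mcoeff ((f * g) * h) M = (\<Sum>(D, C)\<in>msplits M. \<Sum>(A, B)\<in>msplits D.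
      mcoeff f A * mcoeff g B * mcoeff h C)"
    unfolding times_mfps_def by (auto simp: sum_distrib_right intro!: sum.cong)
  also have "\<dots> = (\<Sum>(DC, AB)\<in>Sigma (msplits M) (\<lambda>DC. msplits (fst DC)).
      mcoeff f (fst AB) * mcoeff g (snd AB) * mcoeff h (snd DC))"
    by (subst sum.Sigma[symmetric]) (auto intro!: sum.cong)
  also have "\<dots> = (\<Sum>(AD, BC)\<in>Sigma (msplits M) (\<lambda>AD. msplits (snd AD)).
      mcoeff f (fst AD) * (mcoeff g (fst BC) * mcoeff h (snd BC)))"
    by (rule sum.reindex_bij_witness[where
          i = "\<lambda>((A, D), (B, C)). ((A + B, C), (A, B))" and
          j = "\<lambda>((D, C), (A, B)). ((A, B + C), (B, C))"])
       (auto simp: msplits_def ac_simps)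
  also have "\<dots> = (\<Sum>(A, D)\<in>msplits M. \<Sum>(B, C)\<in>msplits D.
      mcoeff f A * (mcoeff g B * mcoeff h C))"
    by (subst sum.Sigma[symmetric]) (auto intro!: sum.cong)
  also have "\<dots> = mcoeff (f * (g * h)) M"
    unfolding times_mfps_def by (auto simp: sum_distrib_left intro!: sum.cong)
  finally show "mcoeff ((f * g) * h) M = mcoeff (f * (g * h)) M" .
qed

instance
proof
  fix f g h :: "('a, 'b) mfps"
  show "f * g * h = f * (g * h)" by (rule mult_assoc_mfps)
  show "f * g = g * f" by (rule mult_commute_mfps)
  show "1 * f = f" by (rule mult_one_mfps)
  show "(f + g) * h = f * h + g * h"
    by (rule mfps_eqI)
       (simp add: times_mfps_def plus_mfps_def distrib_right sum.distrib case_prod_unfold)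
  show "(0 :: ('a, 'b) mfps) \<noteq> 1"
  proof
    assume "(0 :: ('a, 'b) mfps) = 1"
    then have "mcoeff (0 :: ('a, 'b) mfps) {#} = mcoeff 1 {#}" by simp
    then show False by (simp add: zero_mfps_def one_mfps_def)
  qed
qed (auto intro!: mfps_eqI simp: plus_mfps_def zero_mfps_def minus_mfps_def uminus_mfps_def)

end

definition indet :: "'v \<Rightarrow> ('v, 'a::comm_ring_1) mfps" where
  "indet v = Abs_mfps (\<lambda>M. if M = {#v#} then 1 else 0)"

lemma mcoeff_simps [simp]:
  "mcoeff 0 M = 0"
  "mcoeff 1 M = (if M = {#} then 1 else 0)"
  "mcoeff (f + g) M = mcoeff f M + mcoeff g M"
  "mcoeff (f - g) M = mcoeff f M - mcoeff g M"
  "mcoeff (- f) M = - mcoeff f M"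
  "mcoeff (indet v) M = (if M = {#v#} then 1 else 0)"
  by (simp_all add: zero_mfps_def one_mfps_def plus_mfps_def minus_mfps_def uminus_mfps_def
        indet_def)

lemma mcoeff_mult: "mcoeff (f * g) M = (\<Sum>(A, B)\<in>msplits M. mcoeff f A * mcoeff g B)"
  by (simp add: times_mfps_def)

lemma mcoeff_mult_empty [simp]: "mcoeff (f * g) {#} = mcoeff f {#} * mcoeff g {#}"
  by (simp add: mcoeff_mult)

text \<open>As for univariate series, non-units get inverse 0.\<close>

instantiation mfps :: (type, comm_ring_1) inverse
begin

definition inverse_mfps where
  "inverse (f :: ('a, 'b) mfps) = (if f dvd 1 then THE g :: ('a, 'b) mfps. f * g = 1 else 0)"

definition divide_mfps where
  "(f :: ('a, 'b) mfps) div g = f * inverse g"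

instance ..

end

lemma mult_inverse_mfps:
  fixes f :: "('v, 'a::comm_ring_1) mfps"
  assumes "f dvd 1"
  shows "f * inverse f = 1"
proof -
  obtain g where g: "f * g = 1" using assms by (metis dvdE)
  have "\<exists>!g. f * g = 1"
  proof (rule ex1I[of _ g])
    fix g' assume g': "f * g' = 1"
    have "g' = g' * (f * g)" using g by simp
    also have "\<dots> = f * g' * g" by (simp only: ac_simps)
    finally show "g' = g" using g' by simp
  qed (rule g)
  from theI'[OF this] show ?thesis using assms by (simp add: inverse_mfps_def)
qed

lemma mcoeff_mult_high_power:
  fixes h :: "('v, 'a::comm_ring_1) mfps"
  assumes "mcoeff h {#} = 0" "size M < n"
  shows "mcoeff (g * h ^ n) M = 0"
  using assms(2)
proof (induction n arbitrary: M)
  case (Suc n)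
  have "mcoeff (h * (g * h ^ n)) M = 0"
    unfolding mcoeff_mult[of h]
  proof (rule sum.neutral, clarify)
    fix A B assume AB: "(A, B) \<in> msplits M"
    show "mcoeff h A * mcoeff (g * h ^ n) B = 0"
    proof (cases "A = {#}")
      case False
      then have "0 < size A" by (simp add: nonempty_has_size)
      with AB Suc.prems have "size B < n" by (auto simp: msplits_def)
      then show ?thesis by (simp add: Suc.IH)
    qed (simp add: assms(1))
  qed
  then show ?case by (simp add: algebra_simps)
qed simp

lemma mfps_unit:
  fixes f :: "('v, 'a::comm_ring_1) mfps"
  assumes "mcoeff f {#} = 1"
  shows "f dvd 1"
proof -
  define h where "h = 1 - f"
  have h0: "mcoeff h {#} = 0" using assms by (simp add: h_def)
  have f: "f = 1 - h" by (simp add: h_def)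
  define s where "s n = (\<Sum>i\<le>n. h ^ i)" for n :: nat
  have stab: "mcoeff (s n) M = mcoeff (s (size M)) M" if "size M \<le> n" for n M
    using that
  proof (induction n rule: dec_induct)
    case (step n)
    then show ?case
      using mcoeff_mult_high_power[OF h0, of M "Suc n" 1] by (simp add: s_def)
  qed simp
  define g where "g = Abs_mfps (\<lambda>M. mcoeff (s (size M)) M)"
  have "f * g = 1"
  proof (rule mfps_eqI)
    fix M
    have "mcoeff (f * g) M = mcoeff (f * s (size M)) M"
      unfolding mcoeff_mult
    proof (intro sum.cong refl, clarify)
      fix A B assume "(A, B) \<in> msplits M"
      then have "size B \<le> size M" by (auto simp: msplits_def)
      from stab[OF this] show "mcoeff f A * mcoeff g B = mcoeff f A * mcoeff (s (size M)) B"
        by (simp only: g_def mcoeff_Abs)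
    qed
    also have "f * s (size M) = 1 - h ^ Suc (size M)"
      unfolding f s_def one_diff_power_eq lessThan_Suc_atMost by (rule refl)
    also have "mcoeff \<dots> M = mcoeff 1 M"
      using mcoeff_mult_high_power[OF h0, of M "Suc (size M)" 1] by simp
    finally show "mcoeff (f * g) M = mcoeff 1 M" .
  qed
  then show ?thesis by (metis dvdI)
qed

text \<open>
  Infinite sums and products are taken in the topology of coefficientwise convergence, each
  coefficient being discrete: basic neighbourhoods of \<open>f\<close> fix finitely many coefficients.
\<close>

instantiation mfps :: (type, type) topological_space
begin

definition open_mfps :: "('a, 'b) mfps set \<Rightarrow> bool" where
  "open S \<longleftrightarrow> (\<forall>f\<in>S. \<exists>K. finite K \<and> (\<forall>g. (\<forall>M\<in>K. mcoeff g M = mcoeff f M) \<longrightarrow> g \<in> S))"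

instance
proof
  show "open (UNIV :: ('a, 'b) mfps set)" unfolding open_mfps_def by auto
next
  fix S T :: "('a, 'b) mfps set"
  assume S: "open S" and T: "open T"
  show "open (S \<inter> T)" unfolding open_mfps_def
  proof
    fix f assume f: "f \<in> S \<inter> T"
    obtain K where "finite K" "\<And>g. (\<forall>M\<in>K. mcoeff g M = mcoeff f M) \<Longrightarrow> g \<in> S"
      using S f unfolding open_mfps_def by (metis IntD1)
    moreover obtain L where "finite L" "\<And>g. (\<forall>M\<in>L. mcoeff g M = mcoeff f M) \<Longrightarrow> g \<in> T"
      using T f unfolding open_mfps_def by (metis IntD2)
    ultimately show "\<exists>K. finite K \<and> (\<forall>g. (\<forall>M\<in>K. mcoeff g M = mcoeff f M) \<longrightarrow> g \<in> S \<inter> T)"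
      by (intro exI[of _ "K \<union> L"]) auto
  qed
next
  fix T :: "('a, 'b) mfps set set"
  assume "\<forall>S\<in>T. open S"
  then show "open (\<Union>T)" unfolding open_mfps_def by (meson Union_iff)
qed

end

instance mfps :: (type, type) t2_space
proof
  fix f g :: "('a, 'b) mfps"
  assume "f \<noteq> g"
  then obtain M where M: "mcoeff f M \<noteq> mcoeff g M" using mfps_eqI by blast
  have op: "open {h :: ('a, 'b) mfps. mcoeff h M = a}" for a
    unfolding open_mfps_def by (auto intro!: exI[of _ "{M}"])
  show "\<exists>U V. open U \<and> open V \<and> f \<in> U \<and> g \<in> V \<and> U \<inter> V = {}"
    using M op by (intro exI[of _ "{h. mcoeff h M = mcoeff f M}"]
        exI[of _ "{h. mcoeff h M = mcoeff g M}"]) auto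
qed

lemma tendsto_mfpsI:
  fixes f :: "'b \<Rightarrow> ('v, 'a) mfps"
  assumes "\<And>M. \<forall>\<^sub>F x in F. mcoeff (f x) M = mcoeff l M"
  shows "(f \<longlongrightarrow> l) F"
proof (rule topological_tendstoI)
  fix S assume "open S" "l \<in> S"
  then obtain K where K: "finite K" "\<And>g. (\<forall>M\<in>K. mcoeff g M = mcoeff l M) \<Longrightarrow> g \<in> S"
    unfolding open_mfps_def by metis
  have "\<forall>\<^sub>F x in F. \<forall>M\<in>K. mcoeff (f x) M = mcoeff l M"
    using K(1) assms by (simp add: eventually_ball_finite_distrib)
  then show "\<forall>\<^sub>F x in F. f x \<in> S" by (rule eventually_mono) (use K in auto)
qed

section \<open>The symbols \<open>(a;x)\<^sub>n\<close>\<close>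

definition qpoch :: "'a::comm_ring_1 \<Rightarrow> 'a \<Rightarrow> nat \<Rightarrow> 'a" where
  "qpoch a x n = (\<Prod>k<n. 1 - a * x ^ k)"

definition qpoch_inf :: "'a::{t2_space, comm_ring_1} \<Rightarrow> 'a \<Rightarrow> 'a" where
  "qpoch_inf a x = (\<Prod>k. 1 - a * x ^ k)"

lemma convergent_prod_qpoch:
  fixes a x :: "('v, 'a::comm_ring_1) mfps"
  assumes a: "mcoeff a {#} = 0" and x: "mcoeff x {#} = 0"
  shows "convergent_prod (\<lambda>k. 1 - a * x ^ k)"
proof -
  define P where "P n = (\<Prod>k\<le>n. 1 - a * x ^ k)" for n
  have stab: "mcoeff (P n) M = mcoeff (P (size M)) M" if "size M \<le> n" for n M
    using that
  proof (induction n rule: dec_induct)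
    case (step n)
    have "P (Suc n) = P n - (P n * a) * x ^ Suc n"
      by (simp add: P_def algebra_simps)
    moreover have "mcoeff ((P n * a) * x ^ Suc n) M = 0"
      by (rule mcoeff_mult_high_power[OF x]) (use step in simp)
    ultimately show ?case using step by simp
  qed simp
  define L where "L = Abs_mfps (\<lambda>M. mcoeff (P (size M)) M)"
  have "P \<longlonglongrightarrow> L"
  proof (rule tendsto_mfpsI)
    fix M
    show "\<forall>\<^sub>F n in sequentially. mcoeff (P n) M = mcoeff L M"
      using eventually_ge_at_top[of "size M"]
    proof eventually_elim
      case (elim n)
      from stab[OF this] show ?case by (simp only: L_def mcoeff_Abs)
    qed
  qed
  moreover have "mcoeff L {#} = 1" by (simp add: L_def P_def a)
  then have "L \<noteq> 0" by auto
  ultimately have "raw_has_prod (\<lambda>k. 1 - a * x ^ k) 0 L"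
    unfolding raw_has_prod_def P_def add_0_right by blast
  then show ?thesis unfolding convergent_prod_def by blast
qed

section \<open>Over-partitions\<close>

text \<open>\<open>Over 0\<close> is not an over-lined integer of the paper; it is excluded by \<open>over_nats\<close>.\<close>

datatype part = Plain nat | Over nat

definition over_nats :: "part set" where
  "over_nats = range Plain \<union> Over ` {1..}"

fun psize :: "part \<Rightarrow> nat" where
  "psize (Plain i) = i"
| "psize (Over i) = i"

fun overlined :: "part \<Rightarrow> bool" where
  "overlined (Plain i) = False"
| "overlined (Over i) = True"

instantiation part :: linorder
begin

definition less_eq_part :: "part \<Rightarrow> part \<Rightarrow> bool" where
  "a \<le> b \<longleftrightarrow> psize a < psize b \<or> (psize a = psize b \<and> (overlined b \<longrightarrow> overlined a))"

definition less_part :: "part \<Rightarrow> part \<Rightarrow> bool" where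
  "a < b \<longleftrightarrow> a \<le> b \<and> \<not> b \<le> (a :: part)"

instance
proof
  fix a b c :: part
  show "a < b \<longleftrightarrow> a \<le> b \<and> \<not> b \<le> a" by (rule less_part_def)
  show "a \<le> a" by (simp add: less_eq_part_def)
  show "a \<le> b \<Longrightarrow> b \<le> c \<Longrightarrow> a \<le> c" by (auto simp: less_eq_part_def)
  show "a \<le> b \<Longrightarrow> b \<le> a \<Longrightarrow> a = b" by (cases a; cases b) (auto simp: less_eq_part_def)
  show "a \<le> b \<or> b \<le> a" by (auto simp: less_eq_part_def)
qed

end

text \<open>
  Sequences are indexed from 1; extensionality pins down the irrelevant value at index 0, so that
  each over-partition is represented by exactly one function.
\<close>

definition overpartitions :: "(nat \<Rightarrow> part) set" where
  "overpartitions = {l \<in> {1..} \<rightarrow>\<^sub>E over_nats.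
     antimono_on {1..} l \<and>
     finite {i\<in>{1..}. l i \<noteq> Plain 0} \<and>
     (\<forall>i\<in>{1..}. \<forall>j\<in>{1..}. overlined (l i) \<and> l i = l j \<longrightarrow> i = j)}"

definition plain_partitions :: "(nat \<Rightarrow> part) set" where
  "plain_partitions = {l \<in> overpartitions. \<forall>i\<in>{1..}. \<not> overlined (l i)}"

definition overlined_partitions :: "(nat \<Rightarrow> part) set" where
  "overlined_partitions = {l \<in> overpartitions. \<forall>i\<in>{1..}. 0 < psize (l i) \<longrightarrow> overlined (l i)}"

definition full_overpartitions :: "(nat \<Rightarrow> part) set" where
  "full_overpartitions =
     {l \<in> overpartitions. \<forall>k\<in>{1..}. Over k \<le> l 1 \<longrightarrow> (\<exists>i\<in>{1..}. l i = Over k)}"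

definition weight :: "(nat \<Rightarrow> part) \<Rightarrow> nat" where
  "weight l = (\<Sum>i. psize (l (Suc i)))"

definition residue_weight :: "nat \<Rightarrow> nat \<Rightarrow> (nat \<Rightarrow> part) \<Rightarrow> nat" where
  "residue_weight m i l = (\<Sum>j. psize (l (i + j * m)))"

definition rho :: "nat \<Rightarrow> nat \<Rightarrow> (nat \<Rightarrow> part) \<Rightarrow> int" where
  "rho m j l = (\<Sum>i. int (psize (l (j + i * m))) - int (psize (l (j + 1 + i * m)))
                    - of_bool (overlined (l (j + i * m))))"

definition rho_over :: "nat \<Rightarrow> nat \<Rightarrow> (nat \<Rightarrow> part) \<Rightarrow> nat" where
  "rho_over m j l = card {i. overlined (l (j + i * m))}"

text \<open>Hence no information is lost when \<open>rho\<close> is used as an exponent via \<open>nat\<close>.\<close>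

lemma rho_nonneg:
  assumes l: "l \<in> overpartitions" and "1 \<le> j" "1 \<le> m"
  shows "0 \<le> rho m j l"
proof -
  let ?t = "\<lambda>i. int (psize (l (j + i * m))) - int (psize (l (j + 1 + i * m)))
                - of_bool (overlined (l (j + i * m)))"
  have nonneg: "0 \<le> ?t i" for i
  proof -
    let ?a = "l (j + i * m)" and ?b = "l (j + 1 + i * m)"
    have "?b \<le> ?a"
      using l \<open>1 \<le> j\<close> by (auto simp: overpartitions_def monotone_on_def)
    moreover have "?a \<noteq> ?b" if "overlined ?a"
    proof
      assume "?a = ?b"
      have inj: "\<forall>i\<in>{1..}. \<forall>j\<in>{1..}. overlined (l i) \<and> l i = l j \<longrightarrow> i = j"
        using l unfolding overpartitions_def by blast
      have "j + i * m = j + 1 + i * m"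
        by (rule inj[rule_format]) (use that \<open>?a = ?b\<close> \<open>1 \<le> j\<close> in auto)
      then show False by simp
    qed
    ultimately show ?thesis
      by (cases ?a; cases ?b) (auto simp: less_eq_part_def)
  qed
  have "finite {i\<in>{1..}. l i \<noteq> Plain 0}" using l by (simp add: overpartitions_def)
  then obtain N where "\<And>i. i \<in> {i\<in>{1..}. l i \<noteq> Plain 0} \<Longrightarrow> i \<le> N"
    unfolding finite_nat_set_iff_bounded_le by blast
  then have N: "l i = Plain 0" if "N < i" for i
    using that by (metis (mono_tags, lifting) One_nat_def Suc_leI atLeast_iff gr_zeroI
        less_zeroE linorder_not_less mem_Collect_eq)
  have "?t i = 0" if "i \<notin> {..N}" for i
  proof -
    have "i \<le> i * m" using \<open>1 \<le> m\<close> by simp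
    with that have "N < j + i * m" "N < j + 1 + i * m" unfolding atMost_iff by linarith+
    then show ?thesis by (simp add: N)
  qed
  then have "rho m j l = (\<Sum>i\<le>N. ?t i)"
    unfolding rho_def by (intro suminf_finite) auto
  also have "0 \<le> \<dots>" by (intro sum_nonneg nonneg)
  finally show ?thesis .
qed

text \<open>\<open>Cbar j\<close> is the index of the indeterminate attached to the over-lined \<open>j\<close>.\<close>

datatype indeterminate = Q nat | C nat | Cbar nat

end

theory Submission
  imports Defs
begin

text \<open>
  An over-partition \<open>\<lambda>\<close> is determined by the pairs \<open>(a\<^sub>k, o\<^sub>k)\<close>, where \<open>o\<^sub>k \<in> {0, 1}\<close> tells whether
  \<open>\<lambda>\<^sub>k\<close> is over-lined and \<open>a\<^sub>k = \<lambda>\<^sub>k - \<lambda>\<^sub>k\<^sub>+\<^sub>1 - o\<^sub>k \<ge> 0\<close>, and every finitely supported sequence of such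
  pairs occurs. Summation by parts turns the weight of \<open>\<lambda>\<close> into the product over \<open>k\<close> of
  \<open>(c\<^sub>j Z\<^sub>k)^a\<^sub>k (cb\<^sub>j Z\<^sub>k)^o\<^sub>k\<close>, where \<open>j\<close> is the residue of \<open>k\<close> in \<open>1..m\<close> and \<open>Z\<^sub>k = z\<^sub>j z\<^sub>m^i\<close> for
  \<open>k = j + i m\<close>. Hence the generating functions factor over \<open>k\<close>: all pairs are allowed for
  over-partitions, \<open>o\<^sub>k = 0\<close> describes partitions, \<open>a\<^sub>k = 0\<close> the full over-partitions, and
  \<open>o\<^sub>1 = ... = o\<^sub>N = 1\<close>, followed by zero pairs, the over-lined partitions with \<open>N\<close> parts; in the
  last case one writes \<open>N = n m + \<ell> - 1\<close> and sums over \<open>n\<close> and \<open>\<ell>\<close>.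
\<close>

section \<open>Summation of multivariate power series\<close>

lemma open_mcoeff_eq: "open {h :: ('v, 'a) mfps. mcoeff h M = a}"
  unfolding open_mfps_def by (auto intro!: exI[of _ "{M}"])

lemma tendsto_mfps_iff:
  fixes f :: "'b \<Rightarrow> ('v, 'a) mfps"
  shows "(f \<longlongrightarrow> l) F \<longleftrightarrow> (\<forall>M. \<forall>\<^sub>F x in F. mcoeff (f x) M = mcoeff l M)"
proof
  assume f: "(f \<longlongrightarrow> l) F"
  show "\<forall>M. \<forall>\<^sub>F x in F. mcoeff (f x) M = mcoeff l M"
    using topological_tendstoD[OF f open_mcoeff_eq] by simp
qed (simp add: tendsto_mfpsI)

lemma tendsto_mcoeffD:
  fixes f :: "'b \<Rightarrow> ('v, 'a) mfps"
  assumes "(f \<longlongrightarrow> l) F"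
  shows "\<forall>\<^sub>F x in F. mcoeff (f x) M = mcoeff l M"
  using assms by (simp add: tendsto_mfps_iff)

instance mfps :: (type, comm_ring_1) topological_comm_monoid_add
proof
  fix a b :: "('a, 'b) mfps"
  show "((\<lambda>x. fst x + snd x) \<longlongrightarrow> a + b) (nhds a \<times>\<^sub>F nhds b)"
  proof (rule tendsto_mfpsI)
    fix M
    show "\<forall>\<^sub>F x in nhds a \<times>\<^sub>F nhds b. mcoeff (fst x + snd x) M = mcoeff (a + b) M"
      using tendsto_mcoeffD[OF filterlim_fst, where M = M] tendsto_mcoeffD[OF filterlim_snd, where M = M]
      by eventually_elim simp
  qed
qed

instance mfps :: (type, comm_ring_1) topological_comm_monoid_mult
proof
  fix a b :: "('a, 'b) mfps"
  show "((\<lambda>x. fst x * snd x) \<longlongrightarrow> a * b) (nhds a \<times>\<^sub>F nhds b)"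
  proof (rule tendsto_mfpsI)
    fix M
    \<comment> \<open>The coefficient of a product at \<open>M\<close> involves only the finitely
      many splittings of \<open>M\<close>, so it is settled as soon as finitely many coefficients of
      both factors are.\<close>
    have "\<forall>\<^sub>F x in nhds a \<times>\<^sub>F nhds b. \<forall>p\<in>msplits M.
        mcoeff (fst x) (fst p) = mcoeff a (fst p) \<and> mcoeff (snd x) (snd p) = mcoeff b (snd p)"
      by (intro eventually_ball_finite finite_msplits ballI eventually_conj
            tendsto_mcoeffD filterlim_fst filterlim_snd)
    then show "\<forall>\<^sub>F x in nhds a \<times>\<^sub>F nhds b. mcoeff (fst x * snd x) M = mcoeff (a * b) M"
      by eventually_elim (auto simp: mcoeff_mult intro!: sum.cong)
  qed
qed

lemma mcoeff_sum: "mcoeff (\<Sum>x\<in>A. f x) M = (\<Sum>x\<in>A. mcoeff (f x) M)"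
  by (induction A rule: infinite_finite_induct) simp_all

lemma mcoeff_prod_empty [simp]: "mcoeff (\<Prod>x\<in>A. f x) {#} = (\<Prod>x\<in>A. mcoeff (f x) {#})"
  by (induction A rule: infinite_finite_induct) simp_all

lemma mcoeff_power_empty [simp]: "mcoeff (f ^ n) {#} = mcoeff f {#} ^ n"
  by (induction n) simp_all

text \<open>The coefficient of a product at \<open>M\<close> sees a factor only at submultisets of
  \<open>M\<close>, of which there are finitely many. The truncation arguments for inverses and
  products of sums rest on this.\<close>

lemma mcoeff_mult_eq_0:
  assumes "\<And>B. B \<subseteq># M \<Longrightarrow> mcoeff f B = 0"
  shows "mcoeff (f * g) M = 0"
  unfolding mcoeff_mult
proof (rule sum.neutral, clarify)
  fix A B assume "(A, B) \<in> msplits M"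
  then have "A \<subseteq># M" by (auto simp: msplits_def)
  then show "mcoeff f A * mcoeff g B = 0" by (simp add: assms)
qed

section \<open>Inverses, and the infinite symbols as limits of the finite ones\<close>

lemma inverse_mfps_unique:
  fixes f g :: "('v, 'a::comm_ring_1) mfps"
  assumes "f * g = 1"
  shows "inverse f = g"
proof -
  have "f dvd 1" using assms by (metis dvdI)
  then have "f * inverse f = 1" by (rule mult_inverse_mfps)
  then have "inverse f = inverse f * (f * g)" "g = g * (f * inverse f)"
    using assms by simp_all
  then show ?thesis by (simp add: mult_ac)
qed

lemma mult_inverse_mfps':
  fixes f :: "('v, 'a::comm_ring_1) mfps"
  assumes "mcoeff f {#} = 1"
  shows "f * inverse f = 1"
  by (intro mult_inverse_mfps mfps_unit assms)

lemma inverse_prod_mfps: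
  fixes f :: "'b \<Rightarrow> ('v, 'a::comm_ring_1) mfps"
  assumes "\<And>x. x \<in> A \<Longrightarrow> mcoeff (f x) {#} = 1"
  shows "(\<Prod>x\<in>A. inverse (f x)) = inverse (\<Prod>x\<in>A. f x)"
proof -
  have "(\<Prod>x\<in>A. f x) * (\<Prod>x\<in>A. inverse (f x)) = 1"
    using assms by (simp add: mult_inverse_mfps' flip: prod.distrib)
  then show ?thesis by (simp add: inverse_mfps_unique)
qed

lemma tendsto_inverse_mfps:
  fixes f :: "'b \<Rightarrow> ('v, 'a::comm_ring_1) mfps"
  assumes f: "(f \<longlongrightarrow> l) F" and f1: "\<And>x. mcoeff (f x) {#} = 1" and l1: "mcoeff l {#} = 1"
  shows "((\<lambda>x. inverse (f x)) \<longlongrightarrow> inverse l) F"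
proof (rule tendsto_mfpsI)
  fix M
  have "\<forall>\<^sub>F x in F. \<forall>B\<in>{B. B \<subseteq># M}. mcoeff (f x) B = mcoeff l B"
    by (intro eventually_ball_finite finite_submultisets ballI tendsto_mcoeffD f)
  then show "\<forall>\<^sub>F x in F. mcoeff (inverse (f x)) M = mcoeff (inverse l) M"
  proof eventually_elim
    case (elim x)
    \<comment> \<open>This is 1/f - 1/l = (l - f)/(f l): the factor \<open>l - f x\<close> vanishes
      at every submultiset of \<open>M\<close>.\<close>
    have "inverse (f x) - inverse l =
        (l * inverse l) * inverse (f x) - (f x * inverse (f x)) * inverse l"
      by (simp only: mult_inverse_mfps'[OF f1] mult_inverse_mfps'[OF l1] mult_1_left)
    also have "\<dots> = (l - f x) * (inverse (f x) * inverse l)"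
      by (simp add: algebra_simps)
    also have "mcoeff \<dots> M = 0"
      by (rule mcoeff_mult_eq_0) (use elim in simp)
    finally show ?case by simp
  qed
qed

text \<open>\<open>qpoch_inf\<close> is a \<open>prodinf\<close>, a definite description that
  demands a nonzero limit and treats zero factors separately. It has to be shown that it denotes the
  plain limit of the finite products.\<close>

lemma tendsto_qpoch:
  fixes a x :: "('v, 'a::comm_ring_1) mfps"
  assumes "mcoeff a {#} = 0" "mcoeff x {#} = 0"
  shows "qpoch a x \<longlonglongrightarrow> qpoch_inf a x"
proof -
  \<comment> \<open>Every factor has constant coefficient 1, which rules out the clause of
    \<open>has_prod\<close> for vanishing factors.\<close>
  have nz: "1 - a * x ^ k \<noteq> 0" for k
  proof
    assume "1 - a * x ^ k = 0"
    then have "mcoeff (1 - a * x ^ k) {#} = 0" by simp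
    then show False by (simp add: assms)
  qed
  have raw: "raw_has_prod (\<lambda>k. 1 - a * x ^ k) 0 p \<longleftrightarrow> (\<lambda>k. 1 - a * x ^ k) has_prod p" for p
    using nz by (auto simp: has_prod_def)
  have lim: "qpoch a x \<longlonglongrightarrow> p" if "raw_has_prod (\<lambda>k. 1 - a * x ^ k) 0 p" for p
  proof -
    have "(\<lambda>n. qpoch a x (Suc n)) \<longlonglongrightarrow> p"
      using that by (simp add: raw_has_prod_def qpoch_def lessThan_Suc_atMost)
    then show ?thesis by (simp only: filterlim_sequentially_Suc)
  qed
  obtain N p where p: "raw_has_prod (\<lambda>k. 1 - a * x ^ k) N p"
    using convergent_prod_qpoch[OF assms] by (auto simp: convergent_prod_def)
  have "(\<lambda>n. (\<Prod>k<N. 1 - a * x ^ k) * (\<Prod>k\<le>n. 1 - a * x ^ (k + N)))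
      \<longlonglongrightarrow> (\<Prod>k<N. 1 - a * x ^ k) * p"
    using p by (intro tendsto_mult) (simp_all add: raw_has_prod_def)
  also have "(\<lambda>n. (\<Prod>k<N. 1 - a * x ^ k) * (\<Prod>k\<le>n. 1 - a * x ^ (k + N))) =
      (\<lambda>n. qpoch a x (n + Suc N))"
  proof
    fix n
    show "(\<Prod>k<N. 1 - a * x ^ k) * (\<Prod>k\<le>n. 1 - a * x ^ (k + N)) = qpoch a x (n + Suc N)"
      by (induction n) (simp_all add: qpoch_def mult_ac)
  qed
  finally have L: "qpoch a x \<longlonglongrightarrow> (\<Prod>k<N. 1 - a * x ^ k) * p" (is "_ \<longlonglongrightarrow> ?L")
    by (rule LIMSEQ_offset)
  \<comment> \<open>The coefficient ring may have zero divisors, so \<open>?L\<close> is not nonzero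
    merely because its factors are; its constant coefficient decides.\<close>
  have "mcoeff ?L {#} = 1"
  proof -
    from tendsto_mcoeffD[OF L, of "{#}"]
    have "\<forall>\<^sub>F n in sequentially. mcoeff ?L {#} = 1"
      by eventually_elim (simp add: qpoch_def assms)
    then show ?thesis by simp
  qed
  then have "?L \<noteq> 0" by (metis mcoeff_simps(1) zero_neq_one)
  then have "raw_has_prod (\<lambda>k. 1 - a * x ^ k) 0 ?L"
    using L[folded filterlim_sequentially_Suc[of "qpoch a x"]]
    unfolding raw_has_prod_def qpoch_def lessThan_Suc_atMost by simp
  then have "prodinf (\<lambda>k. 1 - a * x ^ k) = ?L"
    unfolding prodinf_def raw[symmetric]
  proof (rule the_equality)
    show "p' = ?L" if "raw_has_prod (\<lambda>k. 1 - a * x ^ k) 0 p'" for p'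
      by (rule LIMSEQ_unique[OF lim[OF that] L])
  qed
  then show ?thesis using L by (simp add: qpoch_inf_def)
qed

lemma mcoeff_qpoch_empty:
  assumes "mcoeff a {#} = 0"
  shows "mcoeff (qpoch a x n) {#} = 1"
  by (simp add: qpoch_def assms)

lemma mcoeff_qpoch_inf_empty:
  fixes a x :: "('v, 'a::comm_ring_1) mfps"
  assumes "mcoeff a {#} = 0" "mcoeff x {#} = 0"
  shows "mcoeff (qpoch_inf a x) {#} = 1"
proof -
  from tendsto_mcoeffD[OF tendsto_qpoch[OF assms], of "{#}"]
  have "\<forall>\<^sub>F n::nat in sequentially. mcoeff (qpoch_inf a x) {#} = 1"
    by eventually_elim (simp add: mcoeff_qpoch_empty assms)
  then show ?thesis by simp
qed

section \<open>Summable families: criteria, products, geometric series\<close>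

lemma has_sum_mfps_finite_collection:
  fixes f :: "'b \<Rightarrow> ('v, 'a::comm_ring_1) mfps"
  assumes f: "(f has_sum S) A" and "finite \<M>"
  obtains X where "finite X" "X \<subseteq> A"
    "\<And>a M. a \<in> A - X \<Longrightarrow> M \<in> \<M> \<Longrightarrow> mcoeff (f a) M = 0"
    "\<And>M. M \<in> \<M> \<Longrightarrow> mcoeff (sum f X) M = mcoeff S M"
proof -
  have "\<forall>\<^sub>F X in finite_subsets_at_top A. \<forall>M\<in>\<M>. mcoeff (sum f X) M = mcoeff S M"
    using f by (intro eventually_ball_finite assms ballI tendsto_mcoeffD) (simp add: has_sum_def)
  then obtain X where X: "finite X" "X \<subseteq> A"
    "\<forall>Y. finite Y \<and> X \<subseteq> Y \<and> Y \<subseteq> A \<longrightarrow> (\<forall>M\<in>\<M>. mcoeff (sum f Y) M = mcoeff S M)"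
    unfolding eventually_finite_subsets_at_top by meson
  \<comment> \<open>The partial sums over \<open>X\<close> and over \<open>insert a X\<close>
    already have the same coefficient at \<open>M\<close>, so the extra term contributes nothing
    there.\<close>
  have "mcoeff (f a) M = 0" if "a \<in> A - X" "M \<in> \<M>" for a M
    using X(3)[rule_format, of X M] X(3)[rule_format, of "insert a X" M] X(1,2) that
    by (simp add: subset_insertI)
  then show ?thesis using X by (intro that[of X]) auto
qed

text \<open>Converse of the extraction above: if only the terms indexed by \<open>X\<close>
  contribute to a coefficient, all finite sums over supersets of \<open>X\<close> agree
  there.\<close>

lemma has_sum_mfpsI:
  fixes f :: "'b \<Rightarrow> ('v, 'a::comm_ring_1) mfps"
  assumes "\<And>M. \<exists>X. finite X \<and> X \<subseteq> A \<and> (\<forall>a\<in>A - X. mcoeff (f a) M = 0) \<and>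
    mcoeff (sum f X) M = mcoeff S M"
  shows "(f has_sum S) A"
  unfolding has_sum_def
proof (rule tendsto_mfpsI)
  fix M
  obtain X where X: "finite X" "X \<subseteq> A" "\<And>a. a \<in> A - X \<Longrightarrow> mcoeff (f a) M = 0"
    "mcoeff (sum f X) M = mcoeff S M"
    using assms[of M] by blast
  have "mcoeff (sum f Y) M = mcoeff S M" if "finite Y" "X \<subseteq> Y" "Y \<subseteq> A" for Y
  proof -
    have "(\<Sum>a\<in>Y. mcoeff (f a) M) = (\<Sum>a\<in>X. mcoeff (f a) M)"
      by (rule sum.mono_neutral_right) (use that X in auto)
    then show ?thesis using X(4) by (simp add: mcoeff_sum)
  qed
  with X(1,2) show "\<forall>\<^sub>F X in finite_subsets_at_top A. mcoeff (sum f X) M = mcoeff S M"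
    unfolding eventually_finite_subsets_at_top by (intro exI[of _ X]) simp
qed

text \<open>Terms outside \<open>A n\<close> have no monomials of degree at most \<open>n\<close>,
  so the coefficient at \<open>M\<close> is settled at any late enough stage beyond
  \<open>size M\<close>. This is the passage from bounded length to all over-partitions.\<close>

lemma has_sum_mfps_exhaust:
  fixes f :: "'b \<Rightarrow> ('v, 'a::comm_ring_1) mfps"
  assumes f: "\<And>n. (f has_sum S n) (A n)" and sub: "\<And>n. A n \<subseteq> B"
    and zero: "\<And>n x M. x \<in> B - A n \<Longrightarrow> size M \<le> n \<Longrightarrow> mcoeff (f x) M = 0"
    and lim: "S \<longlonglongrightarrow> s"
  shows "(f has_sum s) B"
proof (rule has_sum_mfpsI)
  fix M
  have "\<forall>\<^sub>F n in sequentially. mcoeff (S n) M = mcoeff s M \<and> size M \<le> n"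
    by (intro eventually_conj tendsto_mcoeffD lim eventually_ge_at_top)
  then obtain n where n: "mcoeff (S n) M = mcoeff s M" "size M \<le> n"
    unfolding eventually_sequentially by (meson order_refl)
  obtain X where X: "finite X" "X \<subseteq> A n"
    "\<And>a N. a \<in> A n - X \<Longrightarrow> N \<in> {M} \<Longrightarrow> mcoeff (f a) N = 0"
    "\<And>N. N \<in> {M} \<Longrightarrow> mcoeff (sum f X) N = mcoeff (S n) N"
    by (rule has_sum_mfps_finite_collection[OF f[of n], of "{M}"]) (simp, rule that)
  show "\<exists>X. finite X \<and> X \<subseteq> B \<and> (\<forall>a\<in>B - X. mcoeff (f a) M = 0) \<and>
    mcoeff (sum f X) M = mcoeff s M"
  proof (intro exI[of _ X] conjI ballI)
    show "X \<subseteq> B" using X(2) sub by blast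
    show "mcoeff (f a) M = 0" if "a \<in> B - X" for a
      using X(3)[of a M] zero[of a n M] n(2) that by blast
  qed (use X n in simp_all)
qed

lemma has_sum_mfps_Times:
  fixes f :: "'b \<Rightarrow> ('v, 'a::comm_ring_1) mfps" and g :: "'c \<Rightarrow> ('v, 'a) mfps"
  assumes f: "(f has_sum S) A" and g: "(g has_sum T) B"
  shows "((\<lambda>(a, b). f a * g b) has_sum S * T) (A \<times> B)"
proof (rule has_sum_mfpsI)
  fix M
  obtain X where X: "finite X" "X \<subseteq> A"
    "\<And>a N. a \<in> A - X \<Longrightarrow> N \<in> {N. N \<subseteq># M} \<Longrightarrow> mcoeff (f a) N = 0"
    "\<And>N. N \<in> {N. N \<subseteq># M} \<Longrightarrow> mcoeff (sum f X) N = mcoeff S N"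
    by (rule has_sum_mfps_finite_collection[OF f finite_submultisets[of M]]) (rule that)
  obtain Y where Y: "finite Y" "Y \<subseteq> B"
    "\<And>b N. b \<in> B - Y \<Longrightarrow> N \<in> {N. N \<subseteq># M} \<Longrightarrow> mcoeff (g b) N = 0"
    "\<And>N. N \<in> {N. N \<subseteq># M} \<Longrightarrow> mcoeff (sum g Y) N = mcoeff T N"
    by (rule has_sum_mfps_finite_collection[OF g finite_submultisets[of M]]) (rule that)
  \<comment> \<open>Off the rectangle \<open>X \<times> Y\<close> one of the two factors vanishes at
    all submultisets of \<open>M\<close>.\<close>
  have "mcoeff (f a * g b) M = 0" if "a \<in> A" "b \<in> B" "(a, b) \<notin> X \<times> Y" for a b
  proof (cases "a \<in> X")
    case True
    with that Y(3) show ?thesis by (subst mult.commute) (auto intro: mcoeff_mult_eq_0)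
  next
    case False
    with that X(3) show ?thesis by (auto intro: mcoeff_mult_eq_0)
  qed
  moreover have "mcoeff (\<Sum>(a, b)\<in>X \<times> Y. f a * g b) M = mcoeff (S * T) M"
  proof -
    have "(\<Sum>(a, b)\<in>X \<times> Y. f a * g b) = sum f X * sum g Y"
      by (simp add: sum_product sum.cartesian_product)
    then show ?thesis
      using X(4) Y(4) by (auto simp: mcoeff_mult msplits_def intro!: sum.cong)
  qed
  ultimately show "\<exists>Z. finite Z \<and> Z \<subseteq> A \<times> B \<and>
      (\<forall>p\<in>A \<times> B - Z. mcoeff (case p of (a, b) \<Rightarrow> f a * g b) M = 0) \<and>
      mcoeff (sum (\<lambda>(a, b). f a * g b) Z) M = mcoeff (S * T) M"
    using X(1,2) Y(1,2) by (intro exI[of _ "X \<times> Y"]) auto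
qed

text \<open>Expansion of a finite product of infinite sums. A choice function on
  \<open>insert i I\<close> is a value at \<open>i\<close> together with a choice function on
  \<open>I\<close>, which reduces the claim to two factors.\<close>

lemma has_sum_mfps_PiE:
  fixes f :: "'i \<Rightarrow> 'b \<Rightarrow> ('v, 'a::comm_ring_1) mfps"
  assumes "finite I" "\<And>i. i \<in> I \<Longrightarrow> (f i has_sum S i) (D i)"
  shows "((\<lambda>d. \<Prod>i\<in>I. f i (d i)) has_sum (\<Prod>i\<in>I. S i)) (PiE I D)"
  using assms
proof (induction I rule: finite_induct)
  case empty
  then show ?case by (simp add: has_sum_finite_iff)
next
  case (insert i I)
  have "((\<lambda>(y, d). f i y * (\<Prod>j\<in>I. f j (d j))) has_sum S i * (\<Prod>j\<in>I. S j)) (D i \<times> PiE I D)"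
    by (rule has_sum_mfps_Times) (use insert in auto)
  also have "?this \<longleftrightarrow>
      (((\<lambda>d. \<Prod>j\<in>insert i I. f j (d j)) \<circ> (\<lambda>(y, d). d(i := y))) has_sum (\<Prod>j\<in>insert i I. S j))
        (D i \<times> PiE I D)"
  proof -
    have "(\<Prod>j\<in>I. f j ((d(i := y)) j)) = (\<Prod>j\<in>I. f j (d j))" for d y
      using insert.hyps by (intro prod.cong) auto
    then show ?thesis using insert.hyps by (intro arg_cong2[of _ _ _ _ "\<lambda>h s. (h has_sum s) _"]) (auto simp: fun_eq_iff)
  qed
  also have "\<dots> \<longleftrightarrow>
      ((\<lambda>d. \<Prod>j\<in>insert i I. f j (d j)) has_sum (\<Prod>j\<in>insert i I. S j)) (PiE (insert i I) D)"
    unfolding PiE_insert_eq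
    by (rule has_sum_reindex[symmetric]) (use insert.hyps inj_combinator[of i I] in blast)
  finally show ?case .
qed

lemma has_sum_mfps_geometric:
  fixes x :: "('v, 'a::comm_ring_1) mfps"
  assumes "mcoeff x {#} = 0"
  shows "((\<lambda>n. x ^ n) has_sum inverse (1 - x)) UNIV"
proof (rule has_sum_mfps_exhaust)
  show "((\<lambda>n. x ^ n) has_sum (\<Sum>k\<le>n. x ^ k)) {..n}" for n
    by (simp add: has_sum_finite_iff)
  show "mcoeff (x ^ k) M = 0" if "k \<in> UNIV - {..n}" "size M \<le> n" for n k M
    using mcoeff_mult_high_power[OF assms, of M k 1] that by simp
  show "(\<lambda>n. \<Sum>k\<le>n. x ^ k) \<longlonglongrightarrow> inverse (1 - x)"
  proof (rule tendsto_mfpsI)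
    fix M
    have unit: "(1 - x) * inverse (1 - x) = 1"
      by (rule mult_inverse_mfps') (simp add: assms)
    have "mcoeff (\<Sum>k\<le>n. x ^ k) M = mcoeff (inverse (1 - x)) M" if "size M \<le> n" for n
    proof -
      \<comment> \<open>The finite geometric sum differs from the inverse by a multiple of
        \<open>x ^ Suc n\<close>, which has no monomials of degree at most \<open>n\<close>.\<close>
      have "(\<Sum>k\<le>n. x ^ k) = ((1 - x) * (\<Sum>k<Suc n. x ^ k)) * inverse (1 - x)"
        using unit unfolding lessThan_Suc_atMost by (metis mult.assoc mult.commute mult_1)
      also have "\<dots> = inverse (1 - x) - inverse (1 - x) * x ^ Suc n"
        by (simp only: one_diff_power_eq[symmetric]) (simp add: algebra_simps)
      finally show ?thesis
        using mcoeff_mult_high_power[OF assms, of M "Suc n" "inverse (1 - x)"] that by simp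
    qed
    then show "\<forall>\<^sub>F n in sequentially. mcoeff (\<Sum>k\<le>n. x ^ k) M = mcoeff (inverse (1 - x)) M"
      unfolding eventually_sequentially by blast
  qed
qed simp

text \<open>Ensures that \<open>suminf\<close> denotes a limit: the \<open>n\<close>-th term starts
  in degree \<open>n\<close>, so each coefficient is a finite sum.\<close>

lemma LIMSEQ_suminf_mfps:
  fixes T :: "nat \<Rightarrow> ('v, 'a::comm_ring_1) mfps"
  assumes "\<And>n M. size M < n \<Longrightarrow> mcoeff (T n) M = 0"
  shows "(\<lambda>n. \<Sum>k<n. T k) \<longlonglongrightarrow> suminf T"
proof -
  let ?s = "Abs_mfps (\<lambda>M. \<Sum>k\<le>size M. mcoeff (T k) M)"
  have "(\<lambda>n. \<Sum>k<n. T k) \<longlonglongrightarrow> ?s"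
  proof (rule tendsto_mfpsI)
    fix M
    have "mcoeff (\<Sum>k<n. T k) M = mcoeff ?s M" if "size M < n" for n
      unfolding mcoeff_sum mcoeff_Abs
      by (rule sum.mono_neutral_right) (use that assms in auto)
    then show "\<forall>\<^sub>F n in sequentially. mcoeff (\<Sum>k<n. T k) M = mcoeff ?s M"
      using eventually_gt_at_top[of "size M"] by (rule eventually_mono[rotated])
  qed
  then show ?thesis using sums_def sums_iff by metis
qed

section \<open>Over-partitions as sequences of digits\<close>

definition supported :: "nat \<Rightarrow> (nat \<Rightarrow> part) \<Rightarrow> bool" where
  "supported K l \<longleftrightarrow> (\<forall>k>K. l k = Plain 0)"

text \<open>The digit \<open>a\<close> of the overview. The subtraction of naturals is exact on
  over-partitions, by \<open>overpartition_step\<close>.\<close>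

definition gap :: "(nat \<Rightarrow> part) \<Rightarrow> nat \<Rightarrow> nat" where
  "gap l k = psize (l k) - psize (l (Suc k)) - of_bool (overlined (l k))"

lemma part_eqI: "psize a = psize b \<Longrightarrow> overlined a = overlined b \<Longrightarrow> a = b"
  by (cases a; cases b) auto

lemma overpartition_antimono:
  assumes "l \<in> overpartitions" "1 \<le> i" "i \<le> j"
  shows "l j \<le> l i" "psize (l j) \<le> psize (l i)"
proof -
  show "l j \<le> l i"
    using assms by (auto simp: overpartitions_def monotone_on_def)
  then show "psize (l j) \<le> psize (l i)" by (auto simp: less_eq_part_def)
qed

text \<open>\<open>Over 0\<close> is excluded by \<open>over_nats\<close>, so \<open>Plain 0\<close>
  is the only part of size 0.\<close>

lemma overpartition_size_pos:
  assumes "l \<in> overpartitions" "1 \<le> k" "l k \<noteq> Plain 0"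
  shows "0 < psize (l k)"
proof -
  have "l k \<in> over_nats" using assms by (auto simp: overpartitions_def)
  then show ?thesis using assms(3) by (auto simp: over_nats_def)
qed

text \<open>After an over-lined part the size drops by at least 1: a following part of equal size
  would have to be over-lined too, hence equal, against distinctness.\<close>

lemma overpartition_step:
  assumes l: "l \<in> overpartitions" and k: "1 \<le> k"
  shows "psize (l k) = psize (l (Suc k)) + gap l k + of_bool (overlined (l k))"
proof -
  have le: "l (Suc k) \<le> l k" using overpartition_antimono(1)[OF l k] by simp
  have inj: "\<forall>i\<in>{1..}. \<forall>j\<in>{1..}. overlined (l i) \<and> l i = l j \<longrightarrow> i = j"
    using l unfolding overpartitions_def by blast
  have "l k \<noteq> l (Suc k)" if "overlined (l k)"
    using inj[rule_format, of k "Suc k"] that k by auto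
  then show ?thesis
    using le part_eqI[of "l k" "l (Suc k)"]
    by (auto simp: gap_def less_eq_part_def)
qed

lemma supported_exists:
  assumes "l \<in> overpartitions"
  obtains K where "supported K l"
proof -
  have "finite {i\<in>{1..}. l i \<noteq> Plain 0}" using assms by (simp add: overpartitions_def)
  then obtain K where K: "\<And>i. i \<in> {i\<in>{1..}. l i \<noteq> Plain 0} \<Longrightarrow> i \<le> K"
    unfolding finite_nat_set_iff_bounded_le by blast
  have "l k = Plain 0" if "K < k" for k
  proof (rule ccontr)
    assume "l k \<noteq> Plain 0"
    with that have "k \<le> K" by (intro K) auto
    with that show False by simp
  qed
  then show ?thesis using that by (auto simp: supported_def)
qed

lemma supported_mono: "supported K l \<Longrightarrow> K \<le> N \<Longrightarrow> supported N l"
  by (auto simp: supported_def)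

lemma gap_beyond: "supported K l \<Longrightarrow> K < k \<Longrightarrow> gap l k = 0"
  by (simp add: supported_def gap_def)

lemma overlined_beyond: "supported K l \<Longrightarrow> K < k \<Longrightarrow> \<not> overlined (l k)"
  by (simp add: supported_def)

lemma weight_supported:
  assumes "supported K l"
  shows "weight l = (\<Sum>k=1..K. psize (l k))"
proof -
  have "weight l = (\<Sum>i<K. psize (l (Suc i)))"
    unfolding weight_def by (rule suminf_finite) (use assms in \<open>auto simp: supported_def\<close>)
  also have "\<dots> = (\<Sum>k=1..K. psize (l k))"
    by (simp add: sum.atLeast1_atMost_eq)
  finally show ?thesis .
qed

text \<open>Each of the first \<open>k\<close> parts has size at least 1. This links the length of
  an over-partition to the degree of its weight.\<close>

lemma weight_ge_length:
  assumes l: "l \<in> overpartitions" and "1 \<le> k" "l k \<noteq> Plain 0"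
  shows "k \<le> weight l"
proof -
  obtain K where K: "supported K l" using supported_exists[OF l] by blast
  have "k \<le> K" using K assms(3) by (auto simp: supported_def not_less[symmetric])
  have "1 \<le> psize (l i)" if "i \<in> {1..k}" for i
    using overpartition_antimono(2)[OF l, of i k] overpartition_size_pos[OF assms] that by simp
  then have "(\<Sum>i=1..k. 1) \<le> (\<Sum>i=1..k. psize (l i))" by (rule sum_mono)
  also have "\<dots> \<le> (\<Sum>i=1..K. psize (l i))"
    by (rule sum_mono2) (use \<open>k \<le> K\<close> in auto)
  finally show ?thesis by (simp add: weight_supported[OF K])
qed

text \<open>The sets \<open>A\<close> and \<open>B\<close> select the class: \<open>UNIV\<close> or
  \<open>{0}\<close> for the gaps, and \<open>UNIV\<close>, \<open>{False}\<close> or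
  \<open>{True}\<close> for the flags. They constrain positions up to \<open>K\<close> only; beyond
  \<open>K\<close> the digits are 0 and \<open>False\<close> in any case.\<close>

definition digit_box :: "nat \<Rightarrow> nat set \<Rightarrow> bool set \<Rightarrow> (nat \<Rightarrow> part) set" where
  "digit_box K A B = {l \<in> overpartitions. supported K l \<and>
     (\<forall>k\<in>{1..K}. gap l k \<in> A \<and> overlined (l k) \<in> B)}"

definition digits :: "nat \<Rightarrow> (nat \<Rightarrow> part) \<Rightarrow> nat \<Rightarrow> nat \<times> bool" where
  "digits K l = (\<lambda>k\<in>{1..K}. (gap l k, overlined (l k)))"

definition tail_size :: "nat \<Rightarrow> (nat \<Rightarrow> nat \<times> bool) \<Rightarrow> nat \<Rightarrow> nat" where
  "tail_size K d k = (\<Sum>i=k..K. fst (d i) + of_bool (snd (d i)))"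

text \<open>The test \<open>k \<le> K\<close> is there because \<open>d\<close> may take arbitrary
  values beyond \<open>K\<close>; the restriction to \<open>{1..}\<close> matches the extensional
  representation of over-partitions.\<close>

definition undigits :: "nat \<Rightarrow> (nat \<Rightarrow> nat \<times> bool) \<Rightarrow> nat \<Rightarrow> part" where
  "undigits K d = (\<lambda>k\<in>{1..}. (if k \<le> K \<and> snd (d k) then Over else Plain) (tail_size K d k))"

lemma tail_size_step:
  "k \<le> K \<Longrightarrow> tail_size K d k = fst (d k) + of_bool (snd (d k)) + tail_size K d (Suc k)"
  by (simp add: tail_size_def sum.atLeast_Suc_atMost)

lemma tail_size_beyond: "K < k \<Longrightarrow> tail_size K d k = 0"
  by (simp add: tail_size_def)

lemma tail_size_antimono: "i \<le> j \<Longrightarrow> tail_size K d j \<le> tail_size K d i"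
  unfolding tail_size_def by (rule sum_mono2) auto

lemma
  assumes "1 \<le> k"
  shows psize_undigits: "psize (undigits K d k) = tail_size K d k"
    and overlined_undigits: "overlined (undigits K d k) \<longleftrightarrow> k \<le> K \<and> snd (d k)"
  using assms by (auto simp: undigits_def)

text \<open>A flag adds 1 to the tail sum. This gives the order after an over-lined part as well as
  the distinctness of over-lined parts.\<close>

lemma tail_size_strict:
  assumes "i < j" "i \<le> K" "snd (d i)"
  shows "tail_size K d j < tail_size K d i"
  using tail_size_step[of i K d] tail_size_antimono[of "Suc i" j K d] assms by simp

lemma supported_undigits: "supported K (undigits K d)"
  by (auto simp: supported_def undigits_def tail_size_beyond)

lemma undigits_overpartition: "undigits K d \<in> overpartitions"
proof -
  let ?l = "undigits K d"
  have ext: "?l \<in> {1..} \<rightarrow>\<^sub>E over_nats"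
  proof (rule PiE_I)
    fix k :: nat assume "k \<in> {1..}"
    \<comment> \<open>A set flag contributes 1 to the size, so \<open>Over 0\<close> never
      arises.\<close>
    then show "?l k \<in> over_nats"
      using tail_size_step[of k K d] by (auto simp: undigits_def over_nats_def)
  qed (simp add: undigits_def)
  have mono: "antimono_on {1..} ?l"
  proof (rule monotone_onI)
    fix i j :: nat assume ij: "i \<in> {1..}" "j \<in> {1..}" "i \<le> j"
    show "?l j \<le> ?l i"
    proof (cases "i = j")
      case False
      with ij tail_size_antimono[of i j K d] tail_size_strict[of i j K d] show ?thesis
        by (auto simp: less_eq_part_def psize_undigits overlined_undigits)
    qed simp
  qed
  have distinct: "i = j" if "1 \<le> i" "1 \<le> j" "overlined (?l i)" "?l i = ?l j" for i j
  proof -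
    have "overlined (?l j)" "tail_size K d i = tail_size K d j"
      using that psize_undigits[of i K d] psize_undigits[of j K d] by simp_all
    with that(1-3) have "i \<le> K" "snd (d i)" "j \<le> K" "snd (d j)" "tail_size K d i = tail_size K d j"
      by (simp_all add: overlined_undigits)
    then show ?thesis
      using tail_size_strict[of i j K d] tail_size_strict[of j i K d]
      by (cases i j rule: linorder_cases) auto
  qed
  have "{i\<in>{1..}. ?l i \<noteq> Plain 0} \<subseteq> {..K}"
    using supported_undigits[of K d] by (auto simp: supported_def not_less[symmetric])
  then have "finite {i\<in>{1..}. ?l i \<noteq> Plain 0}" by (rule finite_subset) simp
  with ext mono distinct show ?thesis by (auto simp: overpartitions_def)
qed

lemma gap_undigits:
  assumes "k \<in> {1..K}"
  shows "gap (undigits K d) k = fst (d k)"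
  using assms tail_size_step[of k K d]
  by (simp add: gap_def psize_undigits overlined_undigits)

text \<open>Descending induction from \<open>K\<close>, where the size of the next part is 0: the
  step equation rebuilds each size from the following one.\<close>

lemma undigits_digits:
  assumes l: "l \<in> overpartitions" and K: "supported K l"
  shows "undigits K (digits K l) = l"
proof
  fix k
  show "undigits K (digits K l) k = l k"
  proof (cases "1 \<le> k")
    case False
    then show ?thesis using l by (auto simp: undigits_def overpartitions_def PiE_def extensional_def)
  next
    case True
    have "tail_size K (digits K l) k = psize (l k)"
    proof (cases "k \<le> K")
      case False
      then show ?thesis using K by (simp add: tail_size_beyond supported_def)
    next
      case le: True
      from le True show ?thesis
      proof (induction rule: inc_induct)
        case base
        then show ?case
          using overpartition_step[OF l, of K] K
          by (simp add: tail_size_step tail_size_beyond digits_def supported_def)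
      next
        case (step n)
        then show ?case
          using overpartition_step[OF l, of n] by (simp add: tail_size_step digits_def)
      qed
    qed
    moreover have "overlined (undigits K (digits K l) k) = overlined (l k)"
      using True overlined_beyond[OF K, of k] by (auto simp: overlined_undigits digits_def)
    ultimately show ?thesis
      using True by (intro part_eqI) (simp_all add: psize_undigits)
  qed
qed

text \<open>Turns a sum over over-partitions into a sum over a product set, to which
  \<open>has_sum_mfps_PiE\<close> applies.\<close>

lemma bij_betw_digits: "bij_betw (digits K) (digit_box K A B) (PiE {1..K} (\<lambda>_. A \<times> B))"
proof (rule bij_betw_byWitness[where f' = "undigits K"])
  show "\<forall>l\<in>digit_box K A B. undigits K (digits K l) = l"
    by (auto simp: digit_box_def undigits_digits)
  show "\<forall>d\<in>PiE {1..K} (\<lambda>_. A \<times> B). digits K (undigits K d) = d"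
  proof
    fix d assume "d \<in> PiE {1..K} (\<lambda>_. A \<times> B)"
    then have "d k = undefined" if "k \<notin> {1..K}" for k using that by (rule PiE_arb)
    then show "digits K (undigits K d) = d"
      by (intro ext) (simp add: digits_def restrict_def gap_undigits overlined_undigits)
  qed
  show "digits K ` digit_box K A B \<subseteq> PiE {1..K} (\<lambda>_. A \<times> B)"
    by (auto simp: digits_def digit_box_def PiE_iff)
  show "undigits K ` PiE {1..K} (\<lambda>_. A \<times> B) \<subseteq> digit_box K A B"
  proof
    fix l assume "l \<in> undigits K ` PiE {1..K} (\<lambda>_. A \<times> B)"
    then obtain d where d: "d \<in> PiE {1..K} (\<lambda>_. A \<times> B)" "l = undigits K d" by (rule imageE)
    have "d k \<in> A \<times> B" if "k \<in> {1..K}" for k using d(1) that by (rule PiE_mem)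
    then have "fst (d k) \<in> A \<and> snd (d k) \<in> B" if "k \<in> {1..K}" for k
      using that by (simp add: mem_Times_iff)
    then show "l \<in> digit_box K A B"
      by (auto simp: digit_box_def d(2) undigits_overpartition supported_undigits gap_undigits
          overlined_undigits)
  qed
qed

section \<open>The classes of over-partitions in terms of digits\<close>

lemma full_overpartitions_iff:
  assumes l: "l \<in> overpartitions"
  shows "l \<in> full_overpartitions \<longleftrightarrow> (\<forall>k\<ge>1. gap l k = 0)"
proof
  assume "l \<in> full_overpartitions"
  then have full: "\<exists>i\<ge>1. l i = Over v" if "1 \<le> v" "Over v \<le> l 1" for v
    using that by (auto simp: full_overpartitions_def)
  show "\<forall>k\<ge>1. gap l k = 0"
  proof (intro allI impI)
    fix k :: nat assume k: "1 \<le> k"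
    show "gap l k = 0"
    proof (rule ccontr)
      assume "gap l k \<noteq> 0"
      note stp = overpartition_step[OF l k]
      \<comment> \<open>A positive gap at \<open>k\<close> steps over the size just above
        \<open>l (Suc k)\<close>. Fullness puts \<open>Over v\<close> at some position
        \<open>i\<close>; monotonicity forces \<open>i < k\<close> and size \<open>v\<close> at
        \<open>k\<close>, although the size must drop right after \<open>i\<close>.\<close>
      define v where "v = Suc (psize (l (Suc k)))"
      have "v \<le> psize (l k)" using stp \<open>gap l k \<noteq> 0\<close> by (simp add: v_def)
      also have "\<dots> \<le> psize (l 1)" by (rule overpartition_antimono(2)[OF l _ k]) simp
      finally have "Over v \<le> l 1" by (auto simp: less_eq_part_def)
      then obtain i where i: "1 \<le> i" "l i = Over v" using full[of v] by (auto simp: v_def)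
      have "i \<le> k"
      proof (rule ccontr)
        assume "\<not> i \<le> k"
        then show False
          using overpartition_antimono(2)[OF l, of "Suc k" i] i(2) by (simp add: v_def)
      qed
      then have "psize (l k) \<le> v" using overpartition_antimono(2)[OF l i(1)] i(2) by simp
      then have k_plain: "\<not> overlined (l k)" "psize (l k) = v"
        using stp \<open>gap l k \<noteq> 0\<close> by (auto simp: v_def split: if_splits)
      then have "i < k" using i(2) \<open>i \<le> k\<close> by (metis le_neq_implies_less overlined.simps(2))
      then have "v \<le> psize (l (Suc i))"
        using overpartition_antimono(2)[OF l, of "Suc i" k] k_plain(2) by simp
      then show False using overpartition_step[OF l i(1)] i(2) by simp
    qed
  qed
next
  assume gap: "\<forall>k\<ge>1. gap l k = 0"
  obtain K where K: "supported K l" using supported_exists[OF l] by blast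
  have "\<exists>i\<in>{1..}. l i = Over v" if v: "1 \<le> v" "Over v \<le> l 1" for v
  proof -
    let ?P = "\<lambda>i. 1 \<le> i \<and> v \<le> psize (l i)"
    have P1: "?P 1" using v(2) by (auto simp: less_eq_part_def)
    have bound: "i \<le> K" if "?P i" for i
      using that v(1) K by (auto simp: supported_def not_less[symmetric])
    \<comment> \<open>The last position of size at least \<open>v\<close>: the next size is below
      \<open>v\<close>, and without a gap the drop is at most 1, so this part is
      \<open>Over v\<close>.\<close>
    define i where "i = (GREATEST i. ?P i)"
    have i: "?P i" unfolding i_def by (rule GreatestI_nat[of ?P, OF P1]) (use bound in blast)
    have "\<not> ?P (Suc i)"
      using Greatest_le_nat[of ?P "Suc i" K] bound unfolding i_def[symmetric] by auto
    then have "psize (l i) = v" "overlined (l i)"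
      using i gap overpartition_step[OF l, of i] by (cases "overlined (l i)"; simp)+
    with i show ?thesis by (intro bexI[of _ i] part_eqI) auto
  qed
  with l show "l \<in> full_overpartitions" by (auto simp: full_overpartitions_def)
qed

lemma plain_partitions_iff:
  assumes "l \<in> overpartitions"
  shows "l \<in> plain_partitions \<longleftrightarrow> (\<forall>k\<ge>1. \<not> overlined (l k))"
  using assms by (auto simp: plain_partitions_def)

lemma overlined_partitions_eq: "overlined_partitions = (\<Union>N. digit_box N UNIV {True})"
proof (intro set_eqI iffI)
  fix l assume "l \<in> overlined_partitions"
  then have l: "l \<in> overpartitions" and over: "\<And>k. 1 \<le> k \<Longrightarrow> 0 < psize (l k) \<Longrightarrow> overlined (l k)"
    by (auto simp: overlined_partitions_def)
  obtain K where K: "supported K l" using supported_exists[OF l] by blast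
  \<comment> \<open>The least bound is the number of positive parts: by minimality the part at
    \<open>N\<close>, if \<open>N\<close> is positive, is nonzero, hence so are all earlier
    ones.\<close>
  define N where "N = (LEAST N. supported N l)"
  have N: "supported N l" unfolding N_def by (rule LeastI[of "\<lambda>N. supported N l", OF K])
  have "overlined (l k)" if k: "k \<in> {1..N}" for k
  proof -
    have "\<not> supported (N - 1) l"
      using not_less_Least[of "N - 1" "\<lambda>N. supported N l"] k unfolding N_def[symmetric] by auto
    then obtain i where i: "N - 1 < i" "l i \<noteq> Plain 0" by (auto simp: supported_def)
    have "i \<le> N" using N i(2) by (auto simp: supported_def not_less[symmetric])
    with i k have "i = N" by auto
    with i k have "0 < psize (l N)" by (intro overpartition_size_pos[OF l]) auto
    with k show ?thesis using overpartition_antimono(2)[OF l, of k N] by (intro over) auto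
  qed
  with l N show "l \<in> (\<Union>N. digit_box N UNIV {True})" by (auto simp: digit_box_def)
next
  fix l assume "l \<in> (\<Union>N. digit_box N UNIV {True})"
  then obtain N where "l \<in> digit_box N UNIV {True}" by blast
  then show "l \<in> overlined_partitions"
    by (force simp: digit_box_def overlined_partitions_def supported_def not_less[symmetric])
qed

text \<open>When all flags are set, \<open>N\<close> is the exact number of over-lined parts: the
  part at the larger index would be over-lined and zero at once.\<close>

lemma box_overlined_disjoint:
  assumes "M \<noteq> N"
  shows "digit_box M UNIV {True} \<inter> digit_box N UNIV {True} = {}"
proof -
  have False if "l \<in> digit_box M UNIV {True}" "l \<in> digit_box N UNIV {True}" "M < N" for l M N
    using that overlined_beyond[of M l N] by (auto simp: digit_box_def)
  with assms show ?thesis by (metis disjoint_iff nat_neq_iff)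
qed

section \<open>Weights that are periodic in the index\<close>

text \<open>The residue of a positive \<open>k\<close> is taken in \<open>1..m\<close>, the range of
  the indices of the indeterminates.\<close>

definition cyc :: "nat \<Rightarrow> nat \<Rightarrow> nat" where
  "cyc m k = Suc ((k - 1) mod m)"

lemma cyc_add: "1 \<le> j \<Longrightarrow> j \<le> m \<Longrightarrow> cyc m (j + i * m) = j"
proof -
  assume j: "1 \<le> j" "j \<le> m"
  then have "j + i * m - 1 = (j - 1) + i * m" by simp
  then have "(j + i * m - 1) mod m = (j - 1) mod m" by (metis mod_mult_self1)
  then show ?thesis using j by (simp add: cyc_def)
qed

lemma cyc_id: "1 \<le> j \<Longrightarrow> j \<le> m \<Longrightarrow> cyc m j = j"
  using cyc_add[of j m 0] by simp

text \<open>The induction on \<open>n\<close> appends one block of \<open>m\<close> consecutive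
  indices, which meets each residue class once.\<close>

lemma prod_residue_classes:
  fixes g :: "nat \<Rightarrow> 'r::comm_monoid_mult"
  shows "(\<Prod>k=1..n * m. g k) = (\<Prod>j=1..m. \<Prod>i<n. g (j + i * m))"
proof (induction n)
  case (Suc n)
  have "(\<Prod>k=1..Suc n * m. g k) = (\<Prod>k=1..n * m + m. g k)" by (simp add: add.commute)
  also have "\<dots> = (\<Prod>k=1..n * m. g k) * (\<Prod>k=n * m + 1..n * m + m. g k)"
    by (rule prod.ub_add_nat) simp
  also have "(\<Prod>k=n * m + 1..n * m + m. g k) = (\<Prod>j=1..m. g (j + n * m))"
    using prod.shift_bounds_cl_nat_ivl[of g 1 "n * m" m] by (simp add: add.commute)
  finally show ?case unfolding Suc.IH by (simp add: prod.distrib)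
qed simp

lemma sum_residue_classes:
  fixes g :: "nat \<Rightarrow> 'r::comm_monoid_add"
  shows "(\<Sum>k=1..n * m. g k) = (\<Sum>j=1..m. \<Sum>i<n. g (j + i * m))"
proof (induction n)
  case (Suc n)
  have "(\<Sum>k=1..Suc n * m. g k) = (\<Sum>k=1..n * m + m. g k)" by (simp add: add.commute)
  also have "\<dots> = (\<Sum>k=1..n * m. g k) + (\<Sum>k=n * m + 1..n * m + m. g k)"
    by (rule sum.ub_add_nat) simp
  also have "(\<Sum>k=n * m + 1..n * m + m. g k) = (\<Sum>j=1..m. g (j + n * m))"
    using sum.shift_bounds_cl_nat_ivl[of g 1 "n * m" m] by (simp add: add.commute)
  finally show ?case unfolding Suc.IH by (simp add: sum.distrib)
qed simp

lemma supported_residue: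
  assumes "supported (n * m) l" "1 \<le> j" "n \<le> i"
  shows "l (j + i * m) = Plain 0" "l (Suc (j + i * m)) = Plain 0"
proof -
  have "n * m \<le> i * m" using assms(3) by simp
  then have "n * m < j + i * m" using assms(2) by linarith
  then show "l (j + i * m) = Plain 0" "l (Suc (j + i * m)) = Plain 0"
    using assms(1) by (simp_all add: supported_def)
qed

text \<open>The summands of \<open>rho\<close> are the gaps, so \<open>nat\<close> loses nothing,
  and the support cuts the series to \<open>n\<close> terms.\<close>

lemma rho_eq_sum_gap:
  assumes l: "l \<in> overpartitions" and n: "supported (n * m) l" and j: "1 \<le> j"
  shows "nat (rho m j l) = (\<Sum>i<n. gap l (j + i * m))"
proof -
  have "rho m j l = (\<Sum>i<n. int (psize (l (j + i * m))) - int (psize (l (j + 1 + i * m)))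
      - of_bool (overlined (l (j + i * m))))"
    unfolding rho_def by (rule suminf_finite) (use supported_residue[OF n j] in auto)
  also have "\<dots> = (\<Sum>i<n. int (gap l (j + i * m)))"
  proof (rule sum.cong)
    fix i
    show "int (psize (l (j + i * m))) - int (psize (l (j + 1 + i * m)))
        - of_bool (overlined (l (j + i * m))) = int (gap l (j + i * m))"
      using overpartition_step[OF l, of "j + i * m"] j by simp
  qed simp
  finally show ?thesis by (simp flip: of_nat_sum)
qed

lemma rho_over_eq_sum:
  assumes n: "supported (n * m) l" and j: "1 \<le> j"
  shows "rho_over m j l = (\<Sum>i<n. of_bool (overlined (l (j + i * m))))"
proof -
  have "i < n" if "overlined (l (j + i * m))" for i
    using supported_residue(1)[OF n j, of i] that by (cases "i < n") simp_all
  then have "{i. overlined (l (j + i * m))} = {i \<in> {..<n}. overlined (l (j + i * m))}"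
    by auto
  then show ?thesis by (simp add: rho_over_def Int_def)
qed

lemma residue_weight_eq_sum:
  assumes n: "supported (n * m) l" and j: "1 \<le> j"
  shows "residue_weight m j l = (\<Sum>i<n. psize (l (j + i * m)))"
  unfolding residue_weight_def
  by (rule suminf_finite) (use supported_residue(1)[OF n j] in auto)

text \<open>Summation by parts in multiplicative form. The last factor is the boundary term; it
  becomes 1 once \<open>N\<close> bounds the support.\<close>

lemma telescope_weights:
  fixes y :: "nat \<Rightarrow> 'r::comm_semiring_1"
  assumes l: "l \<in> overpartitions"
  shows "(\<Prod>k=1..N. y k ^ psize (l k)) =
    (\<Prod>k=1..N. (\<Prod>i=1..k. y i) ^ (gap l k + of_bool (overlined (l k)))) *
    (\<Prod>i=1..N. y i) ^ psize (l (Suc N))"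
proof (induction N)
  case (Suc N)
  have "psize (l (Suc N)) =
      gap l (Suc N) + of_bool (overlined (l (Suc N))) + psize (l (Suc (Suc N)))"
    using overpartition_step[OF l, of "Suc N"] by simp
  then have "(\<Prod>i=1..Suc N. y i) ^ psize (l (Suc N)) =
      (\<Prod>i=1..Suc N. y i) ^ (gap l (Suc N) + of_bool (overlined (l (Suc N)))) *
      (\<Prod>i=1..Suc N. y i) ^ psize (l (Suc (Suc N)))"
    by (simp only: power_add)
  moreover have "(\<Prod>k=1..Suc N. y k ^ psize (l k)) =
      (\<Prod>k=1..N. (\<Prod>i=1..k. y i) ^ (gap l k + of_bool (overlined (l k)))) *
      (\<Prod>i=1..Suc N. y i) ^ psize (l (Suc N))"
    using Suc.IH by (simp add: power_mult_distrib mult_ac)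
  ultimately show ?case by (simp add: mult_ac)
qed simp

lemma power_sum_residue_classes:
  fixes u :: "nat \<Rightarrow> 'r::comm_semiring_1"
  shows "(\<Prod>j=1..m. u j ^ (\<Sum>i<n. e (j + i * m))) = (\<Prod>k=1..n * m. u (cyc m k) ^ e k)"
  unfolding prod_residue_classes by (auto simp: power_sum cyc_add intro!: prod.cong)

section \<open>Weighted sums over classes of over-partitions\<close>

locale cyclic_weights =
  fixes m :: nat and q c cb :: "nat \<Rightarrow> ('v, 'a::comm_ring_1) mfps"
  assumes m: "1 \<le> m"
    and q_empty [simp]: "mcoeff (q 0) {#} = 0"
    and c_empty [simp]: "mcoeff (c j) {#} = 0"
    and cb_empty [simp]: "mcoeff (cb j) {#} = 0"
begin

definition z :: "nat \<Rightarrow> ('v, 'a) mfps" where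
  "z i = q 0 ^ i * (\<Prod>k=1..i. q k)"

text \<open>The monomial \<open>Z\<close> of the overview: raising each of the first
  \<open>k\<close> parts by 1, as a unit of gap at \<open>k\<close> does, multiplies the weight by
  it.\<close>

definition zc :: "nat \<Rightarrow> ('v, 'a) mfps" where
  "zc k = (\<Prod>i=1..k. q 0 * q (cyc m i))"

lemma z_empty [simp]: "1 \<le> i \<Longrightarrow> mcoeff (z i) {#} = 0"
  by (simp add: z_def power_0_left)

lemma zm_empty [simp]: "mcoeff (z m) {#} = 0"
  using m by simp

lemma zc_empty [simp]: "1 \<le> k \<Longrightarrow> mcoeff (zc k) {#} = 0"
  by (simp add: zc_def power_0_left)

text \<open>Each full period of \<open>m\<close> indices contributes a factor \<open>z m\<close>;
  the remaining \<open>j\<close> indices give \<open>z j\<close>.\<close>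

lemma zc_residue:
  assumes "1 \<le> j" "j \<le> m"
  shows "zc (j + i * m) = z j * z m ^ i"
proof -
  have small: "zc k = z k" if "k \<le> m" for k
    using that by (auto simp: zc_def z_def prod.distrib cyc_id intro!: prod.cong)
  have shift: "zc (k + m) = z m * zc k" for k
  proof -
    have "cyc m (i + m) = cyc m i" if "1 \<le> i" for i
    proof -
      have "i + m - 1 = (i - 1) + m" using that by simp
      then show ?thesis by (simp add: cyc_def)
    qed
    then have "(\<Prod>i=m + 1..m + k. q 0 * q (cyc m i)) = zc k"
      using prod.shift_bounds_cl_nat_ivl[of "\<lambda>i. q 0 * q (cyc m i)" 1 m k]
      by (simp add: zc_def add.commute)
    then have "zc (m + k) = zc m * zc k"
      unfolding zc_def by (subst prod.ub_add_nat) simp_all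
    then show ?thesis by (simp add: small add.commute)
  qed
  show ?thesis
  proof (induction i)
    case 0
    then show ?case using assms by (simp add: small)
  next
    case (Suc i)
    then show ?case using shift[of "j + i * m"] by (simp add: add_ac mult_ac)
  qed
qed

text \<open>This one summand serves all four identities: on plain partitions the exponents of
  \<open>cb\<close> vanish, on full over-partitions those of \<open>c\<close>.\<close>

definition pweight :: "(nat \<Rightarrow> part) \<Rightarrow> ('v, 'a) mfps" where
  "pweight l = (\<Prod>j=1..m. c j ^ nat (rho m j l) * cb j ^ rho_over m j l)
     * q 0 ^ weight l * (\<Prod>i=1..m. q i ^ residue_weight m i l)"

lemma pweight_eq:
  assumes l: "l \<in> overpartitions" and K: "supported K l"
  shows "pweight l = (\<Prod>k=1..K. (c (cyc m k) * zc k) ^ gap l k *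
    (cb (cyc m k) * zc k) ^ of_bool (overlined (l k)))"
proof -
  \<comment> \<open>The length is extended to a multiple of \<open>m\<close> so that the residue
    classes are filled evenly.\<close>
  define N where "N = K * m"
  have "K \<le> N" using m by (simp add: N_def)
  then have N: "supported (K * m) l" unfolding N_def by (rule supported_mono[OF K])
  have "pweight l = (\<Prod>k=1..N. c (cyc m k) ^ gap l k) *
      (\<Prod>k=1..N. cb (cyc m k) ^ of_bool (overlined (l k))) *
      q 0 ^ (\<Sum>k=1..N. psize (l k)) * (\<Prod>k=1..N. q (cyc m k) ^ psize (l k))"
    unfolding pweight_def N_def prod.distrib weight_supported[OF N]
      power_sum_residue_classes[where u = c and e = "gap l" and n = K and m = m, symmetric]
      power_sum_residue_classes[where u = cb and e = "\<lambda>k. of_bool (overlined (l k))" and n = K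
        and m = m, symmetric]
      power_sum_residue_classes[where u = q and e = "\<lambda>k. psize (l k)" and n = K and m = m, symmetric]
    by (intro arg_cong2[of _ _ _ _ "(*)"] prod.cong refl)
       (simp_all add: rho_eq_sum_gap[OF l N] rho_over_eq_sum[OF N] residue_weight_eq_sum[OF N] del: sum_of_bool_eq)
  also have "\<dots> = (\<Prod>k=1..N. c (cyc m k) ^ gap l k) *
      (\<Prod>k=1..N. cb (cyc m k) ^ of_bool (overlined (l k))) *
      (\<Prod>k=1..N. (q 0 * q (cyc m k)) ^ psize (l k))"
    by (simp add: power_mult_distrib prod.distrib power_sum mult_ac)
  also have "(\<Prod>k=1..N. (q 0 * q (cyc m k)) ^ psize (l k)) =
      (\<Prod>k=1..N. zc k ^ (gap l k + of_bool (overlined (l k))))"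
    using N by (subst telescope_weights[OF l]) (simp add: zc_def supported_def N_def)
  also have "(\<Prod>k=1..N. c (cyc m k) ^ gap l k) *
      (\<Prod>k=1..N. cb (cyc m k) ^ of_bool (overlined (l k))) * \<dots> =
      (\<Prod>k=1..N. (c (cyc m k) * zc k) ^ gap l k *
        (cb (cyc m k) * zc k) ^ of_bool (overlined (l k)))"
    by (simp add: power_add power_mult_distrib prod.distrib mult_ac)
  \<comment> \<open>Beyond \<open>K\<close> both digits are zero and the factors are 1.\<close>
  also have "\<dots> = (\<Prod>k=1..K. (c (cyc m k) * zc k) ^ gap l k *
        (cb (cyc m k) * zc k) ^ of_bool (overlined (l k)))"
    using \<open>K \<le> N\<close> gap_beyond[OF K] overlined_beyond[OF K]
    by (intro prod.mono_neutral_right) auto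
  finally show ?thesis .
qed

lemma mcoeff_pweight_0:
  assumes "size M < weight l"
  shows "mcoeff (pweight l) M = 0"
proof -
  have "pweight l = ((\<Prod>j=1..m. c j ^ nat (rho m j l) * cb j ^ rho_over m j l) *
      (\<Prod>i=1..m. q i ^ residue_weight m i l)) * q 0 ^ weight l"
    by (simp add: pweight_def mult_ac)
  then show ?thesis using mcoeff_mult_high_power[OF q_empty assms] by simp
qed

text \<open>The digits are independent, so each position contributes its own sums:
  \<open>\<alpha>\<close> is the generating function of a gap and \<open>\<beta>\<close> that of a
  flag.\<close>

lemma has_sum_pweight_box:
  assumes A: "\<And>x. mcoeff x {#} = 0 \<Longrightarrow> ((\<lambda>a. x ^ a) has_sum \<alpha> x) A"
    and B: "\<And>x. mcoeff x {#} = 0 \<Longrightarrow> ((\<lambda>b. x ^ of_bool b) has_sum \<beta> x) B"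
  shows "(pweight has_sum (\<Prod>k=1..K. \<alpha> (c (cyc m k) * zc k) * \<beta> (cb (cyc m k) * zc k))) (digit_box K A B)"
proof -
  let ?f = "\<lambda>k (a, b). (c (cyc m k) * zc k) ^ a * (cb (cyc m k) * zc k) ^ of_bool b"
  let ?S = "\<Prod>k=1..K. \<alpha> (c (cyc m k) * zc k) * \<beta> (cb (cyc m k) * zc k)"
  have "((\<lambda>d. \<Prod>k\<in>{1..K}. ?f k (d k)) has_sum ?S) (PiE {1..K} (\<lambda>_. A \<times> B))"
    by (intro has_sum_mfps_PiE has_sum_mfps_Times A B) auto
  then have "((\<lambda>l. \<Prod>k\<in>{1..K}. ?f k (digits K l k)) has_sum ?S) (digit_box K A B)"
    by (subst has_sum_reindex_bij_betw[OF bij_betw_digits])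
  also have "?this \<longleftrightarrow> ?thesis"
    by (rule has_sum_cong) (auto simp: digit_box_def pweight_eq digits_def intro!: prod.cong)
  finally show ?thesis .
qed

text \<open>Common argument for the first three identities. The class is exhausted by boxes of
  length \<open>n * m\<close>; along the residue class of \<open>j\<close> the arguments are
  multiplied by powers of \<open>z m\<close>, and \<open>\<alpha>'\<close> and
  \<open>\<beta>'\<close> are the limits of the resulting products.\<close>

lemma has_sum_pweight_class:
  assumes X: "X \<subseteq> overpartitions" "0 \<in> A" "False \<in> B"
      "\<And>l. l \<in> overpartitions \<Longrightarrow> l \<in> X \<longleftrightarrow> (\<forall>k\<ge>1. gap l k \<in> A \<and> overlined (l k) \<in> B)"
    and A: "\<And>x. mcoeff x {#} = 0 \<Longrightarrow> ((\<lambda>a. x ^ a) has_sum \<alpha> x) A"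
    and B: "\<And>x. mcoeff x {#} = 0 \<Longrightarrow> ((\<lambda>b. x ^ of_bool b) has_sum \<beta> x) B"
    and A': "\<And>x. mcoeff x {#} = 0 \<Longrightarrow> (\<lambda>n. \<Prod>i<n. \<alpha> (x * z m ^ i)) \<longlonglongrightarrow> \<alpha>' x"
    and B': "\<And>x. mcoeff x {#} = 0 \<Longrightarrow> (\<lambda>n. \<Prod>i<n. \<beta> (x * z m ^ i)) \<longlonglongrightarrow> \<beta>' x"
  shows "(pweight has_sum (\<Prod>j=1..m. \<beta>' (cb j * z j) * \<alpha>' (c j * z j))) X"
proof (rule has_sum_mfps_exhaust)
  show "(pweight has_sum (\<Prod>k=1..n * m. \<alpha> (c (cyc m k) * zc k) * \<beta> (cb (cyc m k) * zc k)))
      (digit_box (n * m) A B)" for n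
    by (rule has_sum_pweight_box[OF A B])
  \<comment> \<open>Since \<open>0 \<in> A\<close> and \<open>False \<in> B\<close>, the zero digits
    beyond \<open>N\<close> satisfy the condition of the class.\<close>
  have box: "digit_box N A B = {l \<in> X. supported N l}" for N
  proof (intro set_eqI iffI)
    fix l assume l: "l \<in> digit_box N A B"
    have "gap l k \<in> A \<and> overlined (l k) \<in> B" if "1 \<le> k" for k
    proof (cases "k \<le> N")
      case True
      with l that show ?thesis by (simp add: digit_box_def)
    next
      case False
      with l X(2,3) show ?thesis
        using gap_beyond[of N l k] overlined_beyond[of N l k] by (simp add: digit_box_def)
    qed
    with l X(4) show "l \<in> {l \<in> X. supported N l}" by (simp add: digit_box_def)
  next
    fix l assume l: "l \<in> {l \<in> X. supported N l}"
    then have "l \<in> overpartitions" using X(1) by blast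
    with l X(4)[of l] show "l \<in> digit_box N A B" by (simp add: digit_box_def)
  qed
  show "digit_box (n * m) A B \<subseteq> X" for n by (auto simp: box)
  show "mcoeff (pweight l) M = 0" if "l \<in> X - digit_box (n * m) A B" "size M \<le> n" for l n M
  proof -
    have l: "l \<in> overpartitions" using that X(1) by blast
    have "\<not> supported (n * m) l" using that by (simp add: box)
    \<comment> \<open>A nonzero part beyond position \<open>n * m\<close> makes the weight exceed
      \<open>size M\<close>.\<close>
    then obtain k where k: "n * m < k" "l k \<noteq> Plain 0" by (auto simp: supported_def)
    have "n \<le> n * m" using m by simp
    then have "size M < k" using that(2) k(1) by linarith
    also have "k \<le> weight l" using k by (intro weight_ge_length[OF l]) auto
    finally show ?thesis by (rule mcoeff_pweight_0)
  qed
  have "(\<Prod>k=1..n * m. \<alpha> (c (cyc m k) * zc k) * \<beta> (cb (cyc m k) * zc k)) =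
      (\<Prod>j=1..m. (\<Prod>i<n. \<beta> (cb j * z j * z m ^ i)) * (\<Prod>i<n. \<alpha> (c j * z j * z m ^ i)))" for n
    unfolding prod_residue_classes
    by (auto simp: prod.distrib[symmetric] cyc_add zc_residue mult_ac intro!: prod.cong)
  moreover have "(\<lambda>n. \<Prod>j=1..m. (\<Prod>i<n. \<beta> (cb j * z j * z m ^ i)) * (\<Prod>i<n. \<alpha> (c j * z j * z m ^ i)))
      \<longlonglongrightarrow> (\<Prod>j=1..m. \<beta>' (cb j * z j) * \<alpha>' (c j * z j))"
    by (intro tendsto_prod' tendsto_mult A' B') auto
  ultimately show "(\<lambda>n. \<Prod>k=1..n * m. \<alpha> (c (cyc m k) * zc k) * \<beta> (cb (cyc m k) * zc k))
      \<longlonglongrightarrow> (\<Prod>j=1..m. \<beta>' (cb j * z j) * \<alpha>' (c j * z j))"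
    by simp
qed

lemma prod_geometric:
  assumes "mcoeff x {#} = 0"
  shows "(\<Prod>i<n. inverse (1 - x * z m ^ i)) = inverse (qpoch x (z m) n)"
  unfolding qpoch_def by (rule inverse_prod_mfps) (simp add: assms)

lemma tendsto_prod_geometric:
  assumes "mcoeff x {#} = 0"
  shows "(\<lambda>n. \<Prod>i<n. inverse (1 - x * z m ^ i)) \<longlonglongrightarrow> inverse (qpoch_inf x (z m))"
  unfolding prod_geometric[OF assms]
  by (intro tendsto_inverse_mfps tendsto_qpoch mcoeff_qpoch_empty mcoeff_qpoch_inf_empty assms zm_empty)

lemma tendsto_prod_two_term:
  assumes "mcoeff x {#} = 0"
  shows "(\<lambda>n. \<Prod>i<n. 1 + x * z m ^ i) \<longlonglongrightarrow> qpoch_inf (- x) (z m)"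
  using tendsto_qpoch[of "- x" "z m"] assms by (simp add: qpoch_def[abs_def])

lemma has_sum_two_term: "((\<lambda>b. x ^ of_bool b) has_sum (1 + x)) (UNIV :: bool set)"
  for x :: "('v, 'a) mfps"
  by (simp add: has_sum_finite_iff UNIV_bool)

text \<open>Both digits are free: a gap sums to the geometric series 1/(1 - x), a flag to 1 +
  x.\<close>

lemma has_sum_overpartitions:
  "(pweight has_sum (\<Prod>i=1..m. qpoch_inf (- (cb i * z i)) (z m) / qpoch_inf (c i * z i) (z m)))
    overpartitions"
  unfolding divide_mfps_def
  by (rule has_sum_pweight_class[where A = UNIV and B = UNIV and \<alpha> = "\<lambda>x. inverse (1 - x)" and
        \<beta> = "\<lambda>x. 1 + x" and \<alpha>' = "\<lambda>x. inverse (qpoch_inf x (z m))" and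
        \<beta>' = "\<lambda>x. qpoch_inf (- x) (z m)"])
     (simp_all add: has_sum_mfps_geometric has_sum_two_term tendsto_prod_geometric
        tendsto_prod_two_term)

lemma has_sum_plain_partitions:
  "(pweight has_sum (\<Prod>i=1..m. 1 / qpoch_inf (c i * z i) (z m))) plain_partitions"
proof -
  have "plain_partitions \<subseteq> overpartitions" by (auto simp: plain_partitions_def)
  then show ?thesis
    unfolding divide_mfps_def
    by (rule has_sum_pweight_class[where A = UNIV and B = "{False}" and \<alpha> = "\<lambda>x. inverse (1 - x)" and
          \<beta> = "\<lambda>x. 1" and \<alpha>' = "\<lambda>x. inverse (qpoch_inf x (z m))" and \<beta>' = "\<lambda>x. 1"])
       (simp_all add: has_sum_mfps_geometric tendsto_prod_geometric plain_partitions_iff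
          has_sum_finite_iff)
qed

lemma has_sum_full_overpartitions:
  "(pweight has_sum (\<Prod>i=1..m. qpoch_inf (- (cb i * z i)) (z m))) full_overpartitions"
proof -
  have "full_overpartitions \<subseteq> overpartitions" by (auto simp: full_overpartitions_def)
  \<comment> \<open>The factor 1 is the contribution of the gaps, which are all zero here.\<close>
  then have "(pweight has_sum (\<Prod>i=1..m. qpoch_inf (- (cb i * z i)) (z m) * 1)) full_overpartitions"
    by (rule has_sum_pweight_class[where A = "{0}" and B = UNIV and \<alpha> = "\<lambda>x. 1" and
          \<beta> = "\<lambda>x. 1 + x" and \<alpha>' = "\<lambda>x. 1" and \<beta>' = "\<lambda>x. qpoch_inf (- x) (z m)"])
       (simp_all add: has_sum_two_term tendsto_prod_two_term full_overpartitions_iff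
          has_sum_finite_iff)
  then show ?thesis by simp
qed

section \<open>Over-lined partitions sorted by their number of parts\<close>

definition run :: "nat \<Rightarrow> ('v, 'a) mfps" where
  "run N = (\<Prod>k=1..N. inverse (1 - c (cyc m k) * zc k) * (cb (cyc m k) * zc k))"

lemma has_sum_run: "(pweight has_sum run N) (digit_box N UNIV {True})"
  unfolding run_def
  by (rule has_sum_pweight_box[OF has_sum_mfps_geometric]) (simp_all add: has_sum_finite_iff)

lemma weight_box_overlined:
  assumes "l \<in> digit_box N UNIV {True}"
  shows "N \<le> weight l"
proof (cases "N = 0")
  case False
  with assms have "l \<in> overpartitions" "overlined (l N)" by (auto simp: digit_box_def)
  with False show ?thesis by (intro weight_ge_length) auto
qed simp

text \<open>Read off from the sum over the box instead of the product: all its members have weight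
  at least \<open>N\<close>.\<close>

lemma mcoeff_run_0:
  assumes "size M < N"
  shows "mcoeff (run N) M = 0"
proof -
  obtain X where X: "X \<subseteq> digit_box N UNIV {True}"
    "\<And>M'. M' \<in> {M} \<Longrightarrow> mcoeff (sum pweight X) M' = mcoeff (run N) M'"
    by (rule has_sum_mfps_finite_collection[OF has_sum_run[of N], of "{M}"]) (simp, rule that)
  have "mcoeff (pweight l) M = 0" if "l \<in> X" for l
    using weight_box_overlined[of l N] X(1) that assms by (intro mcoeff_pweight_0) fastforce
  then show ?thesis using X(2)[of M] by (simp add: mcoeff_sum)
qed

lemma prod_run_residue:
  assumes "1 \<le> j" "j \<le> m"
  shows "(\<Prod>i<n. inverse (1 - c (cyc m (j + i * m)) * zc (j + i * m)) *
      (cb (cyc m (j + i * m)) * zc (j + i * m))) =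
    ((cb j * z j) ^ n * z m ^ (n * (n - 1) div 2)) / qpoch (c j * z j) (z m) n"
proof -
  have "(\<Prod>i<n. cb j * (z j * z m ^ i)) = (cb j * z j) ^ n * z m ^ (n * (n - 1) div 2)"
  proof -
    \<comment> \<open>The exponents 0, ..., n - 1 of \<open>z m\<close> along one residue class add
      up to this triangular number.\<close>
    have "(\<Sum>i<n. i) = n * (n - 1) div 2"
      by (cases n) (simp_all add: lessThan_Suc_atMost atMost_atLeast0 gauss_sum_nat mult.commute)
    then show ?thesis
      by (simp add: prod.distrib power_mult_distrib mult_ac flip: power_sum)
  qed
  moreover have "(\<Prod>i<n. inverse (1 - c j * (z j * z m ^ i))) = inverse (qpoch (c j * z j) (z m) n)"
    using prod_geometric[of "c j * z j" n] assms by (simp add: mult.assoc)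
  ultimately show ?thesis
    using assms by (simp add: cyc_add zc_residue prod.distrib divide_mfps_def mult.commute)
qed

text \<open>Among the first \<open>n * m + (L - 1)\<close> positions, the residues below
  \<open>L\<close> occur \<open>n + 1\<close> times and the others \<open>n\<close> times.\<close>

lemma run_residue:
  assumes L: "L \<in> {1..m}"
  shows "run (n * m + (L - 1)) =
    (\<Prod>i=1..<L. ((cb i * z i) ^ (n + 1) * z m ^ (n * (n + 1) div 2))
        / qpoch (c i * z i) (z m) (n + 1))
    * (\<Prod>i=L..m. ((cb i * z i) ^ n * z m ^ (n * (n - 1) div 2))
        / qpoch (c i * z i) (z m) n)"
proof -
  let ?G = "\<lambda>k. inverse (1 - c (cyc m k) * zc k) * (cb (cyc m k) * zc k)"
  have split: "{1..m} = {1..<L} \<union> {L..m}" "{1..<L} \<inter> {L..m} = {}"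
    and "{1..L - 1} = {1..<L}"
    using L by auto
  have "run (n * m + (L - 1)) = (\<Prod>k=1..n * m. ?G k) * (\<Prod>k=n * m + 1..n * m + (L - 1). ?G k)"
    unfolding run_def by (rule prod.ub_add_nat) simp
  also have "(\<Prod>k=n * m + 1..n * m + (L - 1). ?G k) = (\<Prod>j=1..<L. ?G (j + n * m))"
    using prod.shift_bounds_cl_nat_ivl[of ?G 1 "n * m" "L - 1"] \<open>{1..L - 1} = {1..<L}\<close>
    by (simp add: add.commute)
  also have "(\<Prod>k=1..n * m. ?G k) =
      (\<Prod>j=1..<L. \<Prod>i<n. ?G (j + i * m)) * (\<Prod>j=L..m. \<Prod>i<n. ?G (j + i * m))"
    unfolding prod_residue_classes split(1) by (rule prod.union_disjoint) (use split(2) in auto)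
  \<comment> \<open>The incomplete last block supplies the factor with index \<open>n\<close> to the
    residues below \<open>L\<close>.\<close>
  also have "\<dots> * (\<Prod>j=1..<L. ?G (j + n * m)) =
      (\<Prod>j=1..<L. \<Prod>i<Suc n. ?G (j + i * m)) * (\<Prod>j=L..m. \<Prod>i<n. ?G (j + i * m))"
    by (simp add: prod.distrib mult_ac)
  also have "\<dots> = (\<Prod>j=1..<L. ((cb j * z j) ^ Suc n * z m ^ (Suc n * (Suc n - 1) div 2))
        / qpoch (c j * z j) (z m) (Suc n))
    * (\<Prod>j=L..m. ((cb j * z j) ^ n * z m ^ (n * (n - 1) div 2))
        / qpoch (c j * z j) (z m) n)"
    by (intro arg_cong2[of _ _ _ _ "(*)"] prod.cong refl prod_run_residue) (use L in auto)
  also have "Suc n * (Suc n - 1) div 2 = n * (n + 1) div 2" by (simp add: mult.commute)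
  finally show ?thesis by simp
qed

text \<open>The flags form an initial run of \<open>True\<close>, which is not a product condition
  on all positions. The class is therefore summed as a disjoint union of boxes over the number
  \<open>N\<close> of parts.\<close>

lemma has_sum_overlined_partitions:
  "(pweight has_sum (\<Sum>n. \<Sum>L=1..m. run (n * m + (L - 1)))) overlined_partitions"
proof (rule has_sum_mfps_exhaust)
  \<comment> \<open>With the cut at \<open>Suc n * m\<close>, the partitions left out have more than
    \<open>n\<close> parts.\<close>
  let ?A = "\<lambda>n. \<Union>N<Suc n * m. digit_box N UNIV {True}"
  have "(pweight has_sum (\<Sum>N<K. run N)) (\<Union>N<K. digit_box N UNIV {True})" for K
  proof (induction K)
    case (Suc K)
    have disj: "(\<Union>N<K. digit_box N UNIV {True}) \<inter> digit_box K UNIV {True} = {}"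
    proof -
      have "digit_box N UNIV {True} \<inter> digit_box K UNIV {True} = {}" if "N < K" for N
        by (rule box_overlined_disjoint) (use that in simp)
      then show ?thesis by auto
    qed
    have "(\<Union>N<Suc K. digit_box N UNIV {True}) = (\<Union>N<K. digit_box N UNIV {True}) \<union> digit_box K UNIV {True}"
      by (auto simp: lessThan_Suc)
    then show ?case
      using has_sum_Un_disjoint[OF Suc has_sum_run disj] by simp
  qed simp
  then show "(pweight has_sum (\<Sum>N<Suc n * m. run N)) (?A n)" for n .
  show "?A n \<subseteq> overlined_partitions" for n by (auto simp: overlined_partitions_eq)
  show "mcoeff (pweight l) M = 0" if l: "l \<in> overlined_partitions - ?A n" "size M \<le> n" for l n M
  proof -
    obtain N where N: "l \<in> digit_box N UNIV {True}" using l by (auto simp: overlined_partitions_eq)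
    have "\<not> N < Suc n * m"
    proof
      assume "N < Suc n * m"
      with N have "l \<in> ?A n" by (intro UN_I) simp_all
      with l(1) show False by simp
    qed
    moreover have "Suc n \<le> Suc n * m" using mult_le_mono2[OF m, of "Suc n"] by simp
    ultimately have "size M < weight l" using weight_box_overlined[OF N] l(2) by linarith
    then show ?thesis by (rule mcoeff_pweight_0)
  qed
  have group: "(\<Sum>N<n * m. run N) = (\<Sum>t<n. \<Sum>L=1..m. run (t * m + (L - 1)))" for n
  proof -
    \<comment> \<open>The shift by 1 moves \<open>N\<close>, which starts at 0, to the range of the
      residue classes \<open>1..m\<close>.\<close>
    have "(\<Sum>N<n * m. run N) = (\<Sum>k=1..n * m. run (k - 1))"
      by (simp add: sum.atLeast1_atMost_eq)
    also have "\<dots> = (\<Sum>L=1..m. \<Sum>t<n. run (L + t * m - 1))" by (rule sum_residue_classes)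
    also have "\<dots> = (\<Sum>t<n. \<Sum>L=1..m. run (L + t * m - 1))" by (rule sum.swap)
    also have "\<dots> = (\<Sum>t<n. \<Sum>L=1..m. run (t * m + (L - 1)))"
      by (intro sum.cong refl arg_cong[of _ _ run]) auto
    finally show ?thesis .
  qed
  have "(\<lambda>n. \<Sum>t<n. \<Sum>L=1..m. run (t * m + (L - 1))) \<longlonglongrightarrow>
      (\<Sum>n. \<Sum>L=1..m. run (n * m + (L - 1)))"
  proof (rule LIMSEQ_suminf_mfps)
    fix n and M :: "'v multiset" assume "size M < n"
    also have "n \<le> n * m" using m by simp
    finally show "mcoeff (\<Sum>L=1..m. run (n * m + (L - 1))) M = 0"
      by (auto simp: mcoeff_sum intro!: sum.neutral mcoeff_run_0)
  qed
  then show "(\<lambda>n. \<Sum>N<Suc n * m. run N) \<longlonglongrightarrow> (\<Sum>n. \<Sum>L=1..m. run (n * m + (L - 1)))"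
    unfolding group by (rule LIMSEQ_Suc)
qed

end

theorem corollary1p15:
  fixes m :: nat
    and q c cb z :: "nat \<Rightarrow> (indeterminate, 'a::comm_ring_1) mfps"
  assumes m: "1 \<le> m"
    and q: "q = (\<lambda>i. indet (Q i))"
    and c: "c = (\<lambda>j. indet (C j))"
    and cb: "cb = (\<lambda>j. indet (Cbar j))"
    and z: "z = (\<lambda>i. q 0 ^ i * (\<Prod>k=1..i. q k))"
  shows
    "((\<lambda>l. (\<Prod>j=1..m. c j ^ nat (rho m j l) * cb j ^ rho_over m j l)
           * q 0 ^ weight l * (\<Prod>i=1..m. q i ^ residue_weight m i l))
      has_sum (\<Prod>i=1..m. qpoch_inf (- (cb i * z i)) (z m) / qpoch_inf (c i * z i) (z m)))
      overpartitions \<and>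
     ((\<lambda>l. (\<Prod>j=1..m. c j ^ nat (rho m j l))
           * q 0 ^ weight l * (\<Prod>i=1..m. q i ^ residue_weight m i l))
      has_sum (\<Prod>i=1..m. 1 / qpoch_inf (c i * z i) (z m)))
      plain_partitions \<and>
     ((\<lambda>l. (\<Prod>j=1..m. cb j ^ rho_over m j l)
           * q 0 ^ weight l * (\<Prod>i=1..m. q i ^ residue_weight m i l))
      has_sum (\<Prod>i=1..m. qpoch_inf (- (cb i * z i)) (z m)))
      full_overpartitions \<and>
     ((\<lambda>l. (\<Prod>j=1..m. c j ^ nat (rho m j l) * cb j ^ rho_over m j l)
           * q 0 ^ weight l * (\<Prod>i=1..m. q i ^ residue_weight m i l))
      has_sum (\<Sum>n. \<Sum>L=1..m.
          (\<Prod>i=1..<L. ((cb i * z i) ^ (n + 1) * z m ^ (n * (n + 1) div 2))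
                       / qpoch (c i * z i) (z m) (n + 1))
        * (\<Prod>i=L..m. ((cb i * z i) ^ n * z m ^ (n * (n - 1) div 2))
                       / qpoch (c i * z i) (z m) n)))
      overlined_partitions"
proof -
  interpret W: cyclic_weights m q c cb
    using m by unfold_locales (simp_all add: q c cb)
  have zW: "z = W.z" by (simp add: z W.z_def fun_eq_iff)
  have plain: "W.pweight l = (\<Prod>j=1..m. c j ^ nat (rho m j l))
      * q 0 ^ weight l * (\<Prod>i=1..m. q i ^ residue_weight m i l)" if "l \<in> plain_partitions" for l
  proof -
    have "rho_over m j l = 0" if "j \<in> {1..m}" for j
      using that \<open>l \<in> plain_partitions\<close> by (simp add: rho_over_def plain_partitions_def)
    then show ?thesis by (simp add: W.pweight_def)
  qed
  have full: "W.pweight l = (\<Prod>j=1..m. cb j ^ rho_over m j l)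
      * q 0 ^ weight l * (\<Prod>i=1..m. q i ^ residue_weight m i l)" if l: "l \<in> full_overpartitions" for l
  proof -
    have lo: "l \<in> overpartitions" using l by (simp add: full_overpartitions_def)
    obtain K where K: "supported K l" using supported_exists[OF lo] by blast
    \<comment> \<open>\<open>rho\<close> is expanded over a support bounded by a multiple of
      \<open>m\<close>; all gaps of a full over-partition are 0, so its exponents vanish.\<close>
    have "K \<le> K * m" using m by simp
    with K have "supported (K * m) l" by (rule supported_mono)
    then have "nat (rho m j l) = 0" if "j \<in> {1..m}" for j
      using that l lo by (simp add: rho_eq_sum_gap full_overpartitions_iff)
    then show ?thesis by (simp add: W.pweight_def)
  qed
  have overl: "(\<Sum>n. \<Sum>L=1..m. W.run (n * m + (L - 1))) = (\<Sum>n. \<Sum>L=1..m.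
          (\<Prod>i=1..<L. ((cb i * z i) ^ (n + 1) * z m ^ (n * (n + 1) div 2))
                       / qpoch (c i * z i) (z m) (n + 1))
        * (\<Prod>i=L..m. ((cb i * z i) ^ n * z m ^ (n * (n - 1) div 2))
                       / qpoch (c i * z i) (z m) n))"
    unfolding zW by (intro arg_cong[of _ _ suminf] ext sum.cong refl W.run_residue)
  have "(W.pweight has_sum (\<Prod>i=1..m. 1 / qpoch_inf (c i * z i) (z m))) plain_partitions"
    unfolding zW by (rule W.has_sum_plain_partitions)
  then have 2: "((\<lambda>l. (\<Prod>j=1..m. c j ^ nat (rho m j l))
           * q 0 ^ weight l * (\<Prod>i=1..m. q i ^ residue_weight m i l))
      has_sum (\<Prod>i=1..m. 1 / qpoch_inf (c i * z i) (z m))) plain_partitions"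
    by (subst has_sum_cong[OF plain[symmetric]])
  have "(W.pweight has_sum (\<Prod>i=1..m. qpoch_inf (- (cb i * z i)) (z m))) full_overpartitions"
    unfolding zW by (rule W.has_sum_full_overpartitions)
  then have 3: "((\<lambda>l. (\<Prod>j=1..m. cb j ^ rho_over m j l)
           * q 0 ^ weight l * (\<Prod>i=1..m. q i ^ residue_weight m i l))
      has_sum (\<Prod>i=1..m. qpoch_inf (- (cb i * z i)) (z m))) full_overpartitions"
    by (subst has_sum_cong[OF full[symmetric]])
  show ?thesis
    using W.has_sum_overpartitions[unfolded W.pweight_def[abs_def], folded zW] 2 3
      W.has_sum_overlined_partitions[unfolded overl W.pweight_def[abs_def]]
    by (intro conjI)
qed

end
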